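(* There is a universal constant $C>0$ such that for all positive integers $N,M$, every subset $\mathcal{Z}\subseteq\{0,1\}^N\times\{0,1\}^M$ and every Boolean function $f:\mathcal{Z}\to\{0,1\}$ (partial or total), $\mathrm{R}^1(f)\le C\cdot M\cdot\mathrm{Q}^1(f)$; i.e., $\mathrm{R}^1(f)=O(M\,\mathrm{Q}^1(f))$, where $M$ is the length of Bob's input.
   Context: One-way communication: Alice holds $x\in\{0,1\}^N$, Bob holds $y\in\{0,1\}^M$, with $(x,y)\in\mathcal{Z}$ (if $\mathcal{Z}=\{0,1\}^N\times\{0,1\}^M$, $f$ is total, otherwise partial). Alice sends a single message to Bob, and Bob must output $f(x,y)$; there is no communication from Bob to Alice. $\mathrm{R}^1(f)$ is the minimum $k$ such that there is a protocol in which Alice sends a $k$-bit string drawn from a distribution $\mathcal{D}_x$ depending only on $x$, and Bob (as a function of the message and $y$) outputs $f(x,y)$ with probability at least $2/3$ for every $(x,y)\in\mathcal{Z}$. $\mathrm{Q}^1(f)$ is the minimum $k$ such that Alice can send a $k$-qubit mixed state $\rho_x$ depending only on $x$, and Bob, by applying a measurement depending on $y$, outputs $f(x,y)$ with probability at least $2/3$ for every $(x,y)\in\mathcal{Z}$. *)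

theory Defs
  imports "HOL-Probability.Probability_Mass_Function" "Jordan_Normal_Form.Matrix"
begin

text \<open>Bit strings in \<open>{0,1}^n\<close> are boolean lists of length n.  A (partial) Boolean
function is given by a domain \<open>Z\<close> and a function \<open>f\<close>; only values on \<open>Z\<close> matter.\<close>

text \<open>Alice sends a k-bit message drawn from \<open>D x\<close>; Bob outputs \<open>B m y\<close>.\<close>
definition R1_protocol ::
  "(bool list \<times> bool list) set \<Rightarrow> (bool list \<Rightarrow> bool list \<Rightarrow> bool) \<Rightarrow> nat \<Rightarrow> bool" where
  "R1_protocol Z f k \<longleftrightarrow>
     (\<exists>(D :: bool list \<Rightarrow> bool list pmf) (B :: bool list \<Rightarrow> bool list \<Rightarrow> bool).
        (\<forall>x. set_pmf (D x) \<subseteq> {m. length m = k}) \<and>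
        (\<forall>(x, y) \<in> Z. measure_pmf.prob (D x) {m. B m y = f x y} \<ge> 2/3))"

definition R1 :: "(bool list \<times> bool list) set \<Rightarrow> (bool list \<Rightarrow> bool list \<Rightarrow> bool) \<Rightarrow> nat" where
  "R1 Z f = (LEAST k. R1_protocol Z f k)"

definition mtrace :: "complex mat \<Rightarrow> complex" where
  "mtrace A = (\<Sum>i<dim_row A. A $$ (i, i))"

definition psd :: "complex mat \<Rightarrow> bool" where
  "psd A \<longleftrightarrow> A \<in> carrier_mat (dim_row A) (dim_row A) \<and>
     (\<forall>i<dim_row A. \<forall>j<dim_row A. A $$ (i, j) = cnj (A $$ (j, i))) \<and>
     (\<forall>v \<in> carrier_vec (dim_row A).
        0 \<le> Re (\<Sum>i<dim_row A. \<Sum>j<dim_row A. cnj (v $ i) * A $$ (i, j) * v $ j))"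

definition density_mat :: "nat \<Rightarrow> complex mat \<Rightarrow> bool" where
  "density_mat k \<rho> \<longleftrightarrow> \<rho> \<in> carrier_mat (2^k) (2^k) \<and> psd \<rho> \<and> mtrace \<rho> = 1"

text \<open>A two-outcome measurement (POVM) \<open>{E, I - E}\<close> on k qubits; outcome "True"
  corresponds to \<open>E\<close>.\<close>
definition povm_elem :: "nat \<Rightarrow> complex mat \<Rightarrow> bool" where
  "povm_elem k E \<longleftrightarrow> E \<in> carrier_mat (2^k) (2^k) \<and> psd E \<and> psd (1\<^sub>m (2^k) - E)"

definition Q1_protocol ::
  "(bool list \<times> bool list) set \<Rightarrow> (bool list \<Rightarrow> bool list \<Rightarrow> bool) \<Rightarrow> nat \<Rightarrow> bool" where
  "Q1_protocol Z f k \<longleftrightarrow>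
     (\<exists>(\<rho> :: bool list \<Rightarrow> complex mat) (E :: bool list \<Rightarrow> complex mat).
        (\<forall>x. density_mat k (\<rho> x)) \<and> (\<forall>y. povm_elem k (E y)) \<and>
        (\<forall>(x, y) \<in> Z.
           Re (mtrace ((if f x y then E y else 1\<^sub>m (2^k) - E y) * \<rho> x)) \<ge> 2/3))"

definition Q1 :: "(bool list \<times> bool list) set \<Rightarrow> (bool list \<Rightarrow> bool list \<Rightarrow> bool) \<Rightarrow> nat" where
  "Q1 Z f = (LEAST k. Q1_protocol Z f k)"

end

theory Submission
  imports Defs
begin

text \<open>
  Alice does not even need randomness. Bob predicts \<open>f(x, \<cdot>)\<close> by the standard optimal algorithm
  of online learning: on \<open>y\<close> he answers with the bit that keeps the deeper mistake tree. Alice's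
  message tells him where he would err. This costs \<open>O(M)\<close> bits per mistake, and he makes at most as
  many mistakes as the deepest mistake tree has levels.

  A \<open>k\<close>-qubit protocol forces that depth to be \<open>O(k)\<close>. Walk down a mistake tree and collect
  \<open>H = \<Sum>\<^sub>i \<plusminus> A\<^sub>i\<close>, where \<open>A\<^sub>i = 2 E\<^sub>i - I\<close> is the observable of the \<open>i\<close>-th question and the
  sign is the branch taken. A state \<open>\<rho>\<close> at the end of the path has \<open>tr (H \<rho>) \<ge> n/3\<close>. On the other
  hand \<open>tr cosh (s H)\<close> grows on average by at most the factor \<open>cosh s\<close> per step, so some path
  keeps it below \<open>2\<^sup>k (cosh s)\<^sup>n\<close>. A moment of order \<open>\<Theta>(k)\<close> makes the two bounds contradictory for
  large \<open>n/k\<close>. The average growth is controlled by the second derivative of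
  \<open>tr (H + t A)\<^sup>2\<^sup>q\<close>, for which Cauchy-Schwarz and log-convexity replace the Golden-Thompson
  inequality.
\<close>

subsection \<open>Mistake trees\<close>

text \<open>A full binary tree whose nodes are questions \<open>y\<close> and whose paths are all
  realised by some \<open>x\<close>. The largest possible depth is the Littlestone dimension of the
  class of partial functions \<open>f x\<close>, \<open>x \<in> X\<close>. A branch drops every
  \<open>x\<close> for which the question lies outside \<open>Z\<close>.\<close>

primrec mistake_tree ::
  "('a \<times> 'b) set \<Rightarrow> ('a \<Rightarrow> 'b \<Rightarrow> bool) \<Rightarrow> nat \<Rightarrow> 'a set \<Rightarrow> bool" where
  "mistake_tree Z f 0 X \<longleftrightarrow> X \<noteq> {}"
| "mistake_tree Z f (Suc n) X \<longleftrightarrow>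
     (\<exists>y. \<forall>b. mistake_tree Z f n {x \<in> X. (x, y) \<in> Z \<and> f x y = b})"

text \<open>Bob's first hypothesis predicts, for each \<open>y\<close>, the label whose complement leaves a set without
  a tree of depth \<open>n\<close>; an error at \<open>y\<close> sends him to a cover of that smaller set.\<close>
lemma predictor_cover:
  assumes "finite Y" "Z \<subseteq> UNIV \<times> Y" "\<not> mistake_tree Z f n X"
  shows "\<exists>G. finite G \<and> card Y * card G + 1 \<le> (card Y + 1) ^ n \<and>
    (\<forall>x\<in>X. \<exists>g\<in>G. \<forall>y. (x, y) \<in> Z \<longrightarrow> g y = f x y)"
  using assms(3)
proof (induction n arbitrary: X)
  case 0
  then have "X = {}" by simp
  then show ?case by (intro exI[of _ "{}"]) simp
next
  case (Suc n)
  let ?X = "\<lambda>y b. {x \<in> X. (x, y) \<in> Z \<and> f x y = b}"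
  from Suc.prems have "\<forall>y. \<exists>b. \<not> mistake_tree Z f n (?X y b)" by simp
  from choice[OF this] obtain b where b: "\<And>y. \<not> mistake_tree Z f n (?X y (b y))"
    by blast
  have "\<forall>y. \<exists>G. finite G \<and> card Y * card G + 1 \<le> (card Y + 1) ^ n \<and>
      (\<forall>x\<in>?X y (b y). \<exists>g\<in>G. \<forall>y'. (x, y') \<in> Z \<longrightarrow> g y' = f x y')"
    by (rule allI) (rule Suc.IH[OF b])
  from choice[OF this] obtain G where
    G: "\<And>y. finite (G y)" "\<And>y. card Y * card (G y) + 1 \<le> (card Y + 1) ^ n"
      "\<And>y x. x \<in> ?X y (b y) \<Longrightarrow> \<exists>g\<in>G y. \<forall>y'. (x, y') \<in> Z \<longrightarrow> g y' = f x y'"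
    by blast
  \<comment> \<open>One default hypothesis plus a cover for each possible place of an error: sizes
    obey g(n+1) = 1 + |Y| g(n), so |Y| g + 1 gains a factor |Y| + 1 per level. The predecessor
    \<open>c\<close> of the power keeps the count free of subtraction.\<close>
  let ?g = "\<lambda>y. \<not> b y"
  let ?G = "insert ?g (\<Union>y\<in>Y. G y)"
  obtain c where c: "(card Y + 1) ^ n = Suc c"
    using gr0_conv_Suc[of "(card Y + 1) ^ n"] by auto
  then have le: "card Y * card (G y) \<le> c" for y
    using G(2)[of y] by linarith
  have "card Y * card (\<Union>y\<in>Y. G y) \<le> card Y * (\<Sum>y\<in>Y. card (G y))"
    by (intro mult_left_mono card_UN_le assms) simp
  also have "\<dots> = (\<Sum>y\<in>Y. card Y * card (G y))" by (simp add: sum_distrib_left)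
  also have "\<dots> \<le> (\<Sum>y\<in>Y. c)" by (rule sum_mono) (rule le)
  finally have "card Y * card (\<Union>y\<in>Y. G y) \<le> card Y * c" by simp
  moreover have "card ?G \<le> Suc (card (\<Union>y\<in>Y. G y))"
    using card_insert_if[of "\<Union>y\<in>Y. G y" ?g] G(1) assms(1) by simp
  then have "card Y * card ?G \<le> card Y * Suc (card (\<Union>y\<in>Y. G y))"
    by (rule mult_le_mono2)
  ultimately have "card Y * card ?G + 1 \<le> card Y + card Y * c + Suc c"
    unfolding mult_Suc_right by linarith
  then have card: "card Y * card ?G + 1 \<le> (card Y + 1) ^ Suc n"
    using c by simp
  have "\<exists>g\<in>?G. \<forall>y. (x, y) \<in> Z \<longrightarrow> g y = f x y" if x: "x \<in> X" for x
  proof (cases "\<forall>y. (x, y) \<in> Z \<longrightarrow> ?g y = f x y")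
    case True
    then show ?thesis by (intro bexI[of _ ?g]) simp_all
  next
    case False
    then obtain y where y: "(x, y) \<in> Z" "f x y = b y" by auto
    then have "y \<in> Y" using assms(2) by auto
    moreover have "\<exists>g\<in>G y. \<forall>y'. (x, y') \<in> Z \<longrightarrow> g y' = f x y'"
      by (rule G(3)) (use x y in simp)
    ultimately show ?thesis by blast
  qed
  then show ?case using card G(1) assms(1)
    by (intro exI[of _ ?G] conjI ballI) simp_all
qed

subsection \<open>Two facts about real functions\<close>

text \<open>Sturm comparison of the even function F(t) = \<phi>(t) + \<phi>(-t) with cosh(st). Their
  Wronskian \<open>W\<close> vanishes at 0 and has derivative (F'' - s^2 F) cosh(st) \<le> 0, so F /
  cosh(st) is nonincreasing for t \<ge> 0; compare t = 0 with t = 1.\<close>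

lemma cosh_comparison:
  fixes \<phi> :: "real \<Rightarrow> real"
  assumes "\<And>t. (\<phi> has_real_derivative \<phi>' t) (at t)"
    and "\<And>t. (\<phi>' has_real_derivative \<phi>'' t) (at t)"
    and "\<And>t. \<phi>'' t \<le> s\<^sup>2 * \<phi> t"
  shows "\<phi> 1 + \<phi> (- 1) \<le> 2 * cosh s * \<phi> 0"
proof -
  define F where "F t = \<phi> t + \<phi> (- t)" for t
  define F' where "F' t = \<phi>' t - \<phi>' (- t)" for t
  define F'' where "F'' t = \<phi>'' t + \<phi>'' (- t)" for t
  have m: "((\<lambda>t. g (- t)) has_real_derivative - g' (- t)) (at t)"
    if "\<And>t. (g has_real_derivative g' t) (at t)" for g g' t
    using that DERIV_mirror[of g "g' (- t)" t] DERIV_mirror[of g t "g' (- t)"] by blast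
  have F: "(F has_real_derivative F' t) (at t)" for t
    unfolding F_def F'_def using DERIV_add[OF assms(1) m[OF assms(1)], of t] by simp
  have F': "(F' has_real_derivative F'' t) (at t)" for t
    unfolding F'_def F''_def using DERIV_diff[OF assms(2) m[OF assms(2)], of t] by simp
  define W where "W t = F' t * cosh (s * t) - F t * (s * sinh (s * t))" for t
  have W: "(W has_real_derivative (F'' t - s\<^sup>2 * F t) * cosh (s * t)) (at t)" for t
    unfolding W_def
    by (rule derivative_eq_intros F F' refl | simp)+ (simp add: algebra_simps power2_eq_square)
  have neg: "(F'' t - s\<^sup>2 * F t) * cosh (s * t) \<le> 0" for t
    using assms(3)[of t] assms(3)[of "- t"]
    by (intro mult_nonpos_nonneg) (simp_all add: F_def F''_def algebra_simps)
  have W0: "W t \<le> 0" if "t \<ge> 0" for t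
  proof -
    have "W t \<le> W 0"
      by (rule DERIV_nonpos_imp_nonincreasing[OF that]) (use W neg in \<open>intro exI conjI\<close>)
    then show ?thesis by (simp add: W_def F'_def)
  qed
  define Q where "Q t = F t / cosh (s * t)" for t
  have Q: "(Q has_real_derivative W t / (cosh (s * t))\<^sup>2) (at t)" for t
    unfolding Q_def
    by (rule derivative_eq_intros F refl | simp)+
       (simp add: W_def field_simps power2_eq_square)
  have "Q 1 \<le> Q 0"
  proof (rule DERIV_nonpos_imp_nonincreasing[of 0 1 Q])
    fix t :: real assume "0 \<le> t" "t \<le> 1"
    then show "\<exists>y. DERIV Q t :> y \<and> y \<le> 0"
      using Q[of t] W0[of t] by (intro exI[of _ "W t / (cosh (s * t))\<^sup>2"]) (simp add: divide_nonpos_nonneg)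
  qed simp
  then have "F 1 \<le> F 0 * cosh s"
    using cosh_real_pos[of s] by (simp add: Q_def pos_divide_le_eq)
  then show ?thesis by (simp add: F_def mult_ac)
qed

text \<open>A discrete maximum principle. At the first index where the maximum W is attained, an
  interior position would give W^2 \<le> w(j-1) w(j+1) < W^2. Stating convexity with products
  instead of logarithms allows zero values.\<close>

lemma log_convex_le_max:
  fixes w :: "nat \<Rightarrow> real"
  assumes nonneg: "\<And>i. i \<le> m \<Longrightarrow> w i \<ge> 0"
    and conv: "\<And>i. Suc i < m \<Longrightarrow> (w (Suc i))\<^sup>2 \<le> w i * w (Suc (Suc i))"
    and "i \<le> m"
  shows "w i \<le> max (w 0) (w m)"
proof (rule ccontr)
  assume neg: "\<not> ?thesis"
  define W where "W = Max (w ` {..m})"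
  have le: "w j \<le> W" if "j \<le> m" for j unfolding W_def using that by (intro Max_ge) auto
  have gt: "w 0 < W" "w m < W" using le[OF assms(3)] neg by auto
  then have W0: "W > 0" using nonneg[of 0] by simp
  have "\<exists>j. j \<le> m \<and> w j = W"
  proof -
    have "W \<in> w ` {..m}" unfolding W_def by (rule Max_in) auto
    then show ?thesis by auto
  qed
  then obtain j where "j \<le> m \<and> w j = W" and least: "\<And>i. i < j \<Longrightarrow> \<not> (i \<le> m \<and> w i = W)"
    using exists_least_iff[of "\<lambda>j. j \<le> m \<and> w j = W"] by blast
  then have j: "j \<le> m" "w j = W" by auto
  obtain i where i: "j = Suc i" using gt j by (cases j) auto
  have "j \<noteq> m" using gt j by auto
  with j i have im: "Suc i < m" by simp
  have "w i < W" using le[of i] least[of i] im i by fastforce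
  have "W * W \<le> w i * w (Suc (Suc i))" using conv[OF im] j i by (simp add: power2_eq_square)
  also have "\<dots> \<le> w i * W" using le[of "Suc (Suc i)"] nonneg[of i] im by (intro mult_left_mono) auto
  also have "\<dots> < W * W" using \<open>w i < W\<close> W0 by simp
  finally show False by simp
qed

subsection \<open>The Hilbert-Schmidt inner product\<close>

definition adjoint_mat :: "complex mat \<Rightarrow> complex mat" where
  "adjoint_mat A = mat (dim_col A) (dim_row A) (\<lambda>(i, j). cnj (A $$ (j, i)))"

text \<open>The real part makes this the Euclidean inner product of the entries viewed as a real
  vector, so the Cauchy-Schwarz inequality is one between real numbers.\<close>

definition hs_inner :: "complex mat \<Rightarrow> complex mat \<Rightarrow> real" where
  "hs_inner X Y = Re (mtrace (adjoint_mat X * Y))"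

abbreviation hermitian :: "complex mat \<Rightarrow> bool" where
  "hermitian A \<equiv> adjoint_mat A = A"

lemma adjoint_mat_carrier [simp]: "A \<in> carrier_mat n m \<Longrightarrow> adjoint_mat A \<in> carrier_mat m n"
  by (simp add: adjoint_mat_def)

lemma adjoint_mat_mult:
  assumes "A \<in> carrier_mat n m" "B \<in> carrier_mat m k"
  shows "adjoint_mat (A * B) = adjoint_mat B * adjoint_mat A"
proof (rule eq_matI)
  fix i j assume ij: "i < dim_row (adjoint_mat B * adjoint_mat A)" "j < dim_col (adjoint_mat B * adjoint_mat A)"
  then have "i < k" "j < n" using assms by (auto simp: adjoint_mat_def)
  then show "adjoint_mat (A * B) $$ (i, j) = (adjoint_mat B * adjoint_mat A) $$ (i, j)"
    using assms by (simp add: adjoint_mat_def scalar_prod_def mult.commute)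
qed (use assms in \<open>simp_all add: adjoint_mat_def\<close>)

lemma adjoint_mat_one [simp]: "adjoint_mat (1\<^sub>m n) = 1\<^sub>m n"
  by (rule eq_matI) (auto simp: adjoint_mat_def)

lemma hermitianI:
  assumes "A \<in> carrier_mat d d"
    and "\<And>i j. i < d \<Longrightarrow> j < d \<Longrightarrow> A $$ (i, j) = cnj (A $$ (j, i))"
  shows "hermitian A"
proof (rule eq_matI)
  fix i j assume "i < dim_row A" "j < dim_col A"
  then have "i < d" "j < d" using assms(1) by auto
  then have "adjoint_mat A $$ (i, j) = cnj (A $$ (j, i))"
    using assms(1) by (simp add: adjoint_mat_def)
  also have "\<dots> = A $$ (i, j)" by (rule assms(2)[symmetric]) fact+
  finally show "adjoint_mat A $$ (i, j) = A $$ (i, j)" .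
qed (use assms(1) in \<open>simp_all add: adjoint_mat_def\<close>)

lemma mult_mat_index:
  "A \<in> carrier_mat d d \<Longrightarrow> B \<in> carrier_mat d d \<Longrightarrow> i < d \<Longrightarrow> j < d \<Longrightarrow>
   (A * B) $$ (i, j) = (\<Sum>l<d. A $$ (i, l) * B $$ (l, j))"
  by (simp add: scalar_prod_def atLeast0LessThan)

context
  fixes d :: nat
begin

private abbreviation (input) M :: "complex mat set" where "M \<equiv> carrier_mat d d"

lemma mult_square_mat: "A \<in> M \<Longrightarrow> B \<in> M \<Longrightarrow> A * B \<in> M"
  by simp

lemma assoc_square_mat: "A \<in> M \<Longrightarrow> B \<in> M \<Longrightarrow> C \<in> M \<Longrightarrow> A * B * C = A * (B * C)"
  by (rule assoc_mult_mat)

lemma mtrace_carrier: "A \<in> M \<Longrightarrow> mtrace A = (\<Sum>i<d. A $$ (i, i))"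
  by (simp add: mtrace_def)

lemma mtrace_add: "A \<in> M \<Longrightarrow> B \<in> M \<Longrightarrow> mtrace (A + B) = mtrace A + mtrace B"
  by (simp add: mtrace_def sum.distrib)

lemma mtrace_minus: "A \<in> M \<Longrightarrow> B \<in> M \<Longrightarrow> mtrace (A - B) = mtrace A - mtrace B"
  by (simp add: mtrace_def sum_subtractf)

lemma mtrace_smult: "A \<in> M \<Longrightarrow> mtrace (c \<cdot>\<^sub>m A) = c * mtrace A"
  by (simp add: mtrace_def sum_distrib_left)

lemma mtrace_mult_comm:
  assumes "A \<in> M" "B \<in> M"
  shows "mtrace (A * B) = mtrace (B * A)"
proof -
  have "mtrace (A * B) = (\<Sum>i<d. \<Sum>j<d. A $$ (i, j) * B $$ (j, i))"
    using assms by (simp add: mtrace_carrier mult_mat_index del: index_mult_mat)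
  also have "\<dots> = (\<Sum>j<d. \<Sum>i<d. A $$ (i, j) * B $$ (j, i))" by (rule sum.swap)
  also have "\<dots> = mtrace (B * A)"
    using assms by (simp add: mtrace_carrier mult_mat_index mult.commute del: index_mult_mat)
  finally show ?thesis .
qed

lemma hs_inner_sum:
  assumes "X \<in> M" "Y \<in> M"
  shows "hs_inner X Y = (\<Sum>(i, j)\<in>{..<d} \<times> {..<d}. Re (cnj (X $$ (j, i)) * Y $$ (j, i)))"
proof -
  have "mtrace (adjoint_mat X * Y) = (\<Sum>i<d. \<Sum>j<d. cnj (X $$ (j, i)) * Y $$ (j, i))"
    using assms mtrace_carrier[OF mult_square_mat[of "adjoint_mat X" Y]] mult_mat_index[of "adjoint_mat X" d Y]
    by (simp add: adjoint_mat_def del: index_mult_mat)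
  then show ?thesis by (simp add: hs_inner_def sum.cartesian_product split_def)
qed

lemma hs_inner_self_sum:
  assumes "X \<in> M"
  shows "hs_inner X X = (\<Sum>(i, j)\<in>{..<d} \<times> {..<d}. (cmod (X $$ (j, i)))\<^sup>2)"
  unfolding hs_inner_sum[OF assms assms]
  by (intro sum.cong refl) (auto simp: cmod_power2 simp flip: power2_eq_square)

lemma hs_inner_self_nonneg: "X \<in> M \<Longrightarrow> hs_inner X X \<ge> 0"
  by (subst hs_inner_self_sum) (auto intro!: sum_nonneg)

lemma hs_inner_Cauchy_Schwarz:
  assumes "X \<in> M" "Y \<in> M"
  shows "(hs_inner X Y)\<^sup>2 \<le> hs_inner X X * hs_inner Y Y"
proof -
  let ?S = "{..<d} \<times> {..<d}"
  have "\<bar>hs_inner X Y\<bar> \<le> (\<Sum>(i, j)\<in>?S. cmod (X $$ (j, i)) * cmod (Y $$ (j, i)))"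
    unfolding hs_inner_sum[OF assms]
  proof (rule order_trans[OF sum_abs], rule sum_mono, clarify)
    fix i j
    show "\<bar>Re (cnj (X $$ (j, i)) * Y $$ (j, i))\<bar> \<le> cmod (X $$ (j, i)) * cmod (Y $$ (j, i))"
      using abs_Re_le_cmod[of "cnj (X $$ (j, i)) * Y $$ (j, i)"] by (simp add: norm_mult)
  qed
  then have "\<bar>hs_inner X Y\<bar>\<^sup>2 \<le> (\<Sum>(i, j)\<in>?S. cmod (X $$ (j, i)) * cmod (Y $$ (j, i)))\<^sup>2"
    by (rule power_mono) simp
  also have "\<dots> \<le> (\<Sum>(i, j)\<in>?S. (cmod (X $$ (j, i)))\<^sup>2) * (\<Sum>(i, j)\<in>?S. (cmod (Y $$ (j, i)))\<^sup>2)"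
    using Cauchy_Schwarz_ineq_sum[of "\<lambda>(i, j). cmod (X $$ (j, i))" "\<lambda>(i, j). cmod (Y $$ (j, i))" ?S]
    by (simp add: case_prod_beta)
  finally show ?thesis using assms by (simp add: hs_inner_self_sum)
qed

section \<open>Traces of powers of Hermitian matrices\<close>

lemma pow_mat_add:
  assumes "A \<in> M"
  shows "A ^\<^sub>m (m + n) = A ^\<^sub>m m * A ^\<^sub>m n"
proof (induction n)
  case (Suc n)
  then show ?case using assms by (simp add: assoc_square_mat[of "A ^\<^sub>m m"])
qed (use assms in simp)

lemma hermitian_pow:
  assumes "A \<in> M" "hermitian A"
  shows "hermitian (A ^\<^sub>m n)"
proof (induction n)
  case (Suc n)
  have "adjoint_mat (A ^\<^sub>m Suc n) = adjoint_mat A * adjoint_mat (A ^\<^sub>m n)"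
    using adjoint_mat_mult[of "A ^\<^sub>m n" d d A d] assms by simp
  also have "\<dots> = A ^\<^sub>m 1 * A ^\<^sub>m n" using Suc assms by simp
  also have "\<dots> = A ^\<^sub>m Suc n" using pow_mat_add[OF assms(1), of 1 n] by simp
  finally show ?case .
qed (use assms in simp)

lemma trace_even_pow:
  assumes "A \<in> M" "hermitian A"
  shows "Re (mtrace (A ^\<^sub>m (2 * m))) = hs_inner (A ^\<^sub>m m) (A ^\<^sub>m m)"
  unfolding hs_inner_def hermitian_pow[OF assms] mult_2 pow_mat_add[OF assms(1)] ..

lemma trace_even_pow_nonneg:
  assumes "A \<in> M" "hermitian A"
  shows "Re (mtrace (A ^\<^sub>m (2 * m))) \<ge> 0"
  unfolding trace_even_pow[OF assms] using assms by (simp add: hs_inner_self_nonneg)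

text \<open>Operator norm at most 1, expressed through Hilbert-Schmidt norms so that it enters trace
  estimates without any spectral theory.\<close>

definition hs_contraction :: "complex mat \<Rightarrow> bool" where
  "hs_contraction A \<longleftrightarrow> (\<forall>X\<in>M. hs_inner (A * X) (A * X) \<le> hs_inner X X)"

text \<open>Cyclicity of the trace merges the exponents on each side of \<open>A\<close>.
  Cauchy-Schwarz for the matrices \<open>L ^\<^sub>m i * (A * L ^\<^sub>m j)\<close> thereby becomes
  log-convexity in the exponents.\<close>

lemma hs_inner_sandwich:
  assumes "L \<in> M" "A \<in> M" "hermitian L" "hermitian A"
  shows "hs_inner (L ^\<^sub>m i * (A * L ^\<^sub>m j)) (L ^\<^sub>m i' * (A * L ^\<^sub>m j')) =
    Re (mtrace (L ^\<^sub>m (i + i') * (A * (L ^\<^sub>m (j + j') * A))))"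
proof -
  note [simp] = assms hermitian_pow pow_carrier_mat[OF assms(1)] mult_square_mat
  have "adjoint_mat (L ^\<^sub>m i * (A * L ^\<^sub>m j)) = L ^\<^sub>m j * A * L ^\<^sub>m i"
    by (subst adjoint_mat_mult[of _ d d _ d], simp, simp, subst adjoint_mat_mult[of _ d d _ d]) simp_all
  then have "adjoint_mat (L ^\<^sub>m i * (A * L ^\<^sub>m j)) * (L ^\<^sub>m i' * (A * L ^\<^sub>m j')) =
      (L ^\<^sub>m j * A) * (L ^\<^sub>m (i + i') * (A * L ^\<^sub>m j'))"
    by (simp add: assoc_square_mat pow_mat_add)
  also have "mtrace \<dots> = mtrace (L ^\<^sub>m (i + i') * (A * L ^\<^sub>m j') * (L ^\<^sub>m j * A))"
    by (rule mtrace_mult_comm) simp_all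
  also have "\<dots> = mtrace (L ^\<^sub>m (i + i') * (A * (L ^\<^sub>m (j' + j) * A)))"
    by (simp add: assoc_square_mat pow_mat_add)
  finally show ?thesis by (simp add: hs_inner_def add.commute)
qed

text \<open>As a function of \<open>a\<close> (even, with \<open>a + b\<close> fixed) the left-hand side is log-convex by
  Cauchy-Schwarz, so it is largest at the two ends, where it is \<open>tr (A L\<^sup>2\<^sup>m A)\<close>.\<close>
lemma trace_sandwich_le:
  assumes "L \<in> M" "A \<in> M" "hermitian L" "hermitian A" "hs_contraction A" "a + b = 2 * m"
  shows "Re (mtrace (L ^\<^sub>m a * (A * (L ^\<^sub>m b * A)))) \<le> Re (mtrace (L ^\<^sub>m (2 * m)))"
proof -
  define u where "u a b = Re (mtrace (L ^\<^sub>m a * (A * (L ^\<^sub>m b * A))))" for a b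
  note [simp] = assms(1-4) carrier_matD[OF assms(1)] pow_carrier_mat[OF assms(1)] mult_square_mat
    left_mult_one_mat[of _ d d]
  have sq: "u (i + i) (j + j) = hs_inner (L ^\<^sub>m i * (A * L ^\<^sub>m j)) (L ^\<^sub>m i * (A * L ^\<^sub>m j))" for i j
    unfolding u_def by (simp add: hs_inner_sandwich)
  have pos: "u (i + i) (j + j) \<ge> 0" for i j
    unfolding sq by (simp add: hs_inner_self_nonneg)
  have cs: "(u (i + i') (j + j'))\<^sup>2 \<le> u (i + i) (j + j) * u (i' + i') (j' + j')" for i i' j j'
    using hs_inner_Cauchy_Schwarz[of "L ^\<^sub>m i * (A * L ^\<^sub>m j)" "L ^\<^sub>m i' * (A * L ^\<^sub>m j')"]
    unfolding u_def by (simp add: hs_inner_sandwich)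
  define w where "w i = u (i + i) ((m - i) + (m - i))" for i
  have ends: "w m = w 0"
    using mtrace_mult_comm[of "L ^\<^sub>m (m + m) * A" A]
      mtrace_mult_comm[of A "L ^\<^sub>m (m + m) * A"]
    by (simp add: w_def u_def assoc_square_mat)
  have "w 0 = hs_inner (A * L ^\<^sub>m m) (A * L ^\<^sub>m m)"
    using sq[of 0 m] by (simp add: w_def left_mult_one_mat[of _ d d])
  also have "\<dots> \<le> hs_inner (L ^\<^sub>m m) (L ^\<^sub>m m)"
    using assms(5) by (simp add: hs_contraction_def)
  finally have w0: "w 0 \<le> Re (mtrace (L ^\<^sub>m (2 * m)))" by (simp add: trace_even_pow)
  have w: "w i \<le> w 0" if "i \<le> m" for i
  proof -
    have "w i \<le> max (w 0) (w m)"
    proof (rule log_convex_le_max[OF _ _ that])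
      fix j assume "Suc j < m"
      then obtain k where "m = Suc (Suc j) + k" using less_iff_Suc_add[of "Suc j" m] by auto
      then show "(w (Suc j))\<^sup>2 \<le> w j * w (Suc (Suc j))"
        using cs[of j "Suc (Suc j)" "Suc (Suc k)" k] by (simp add: w_def)
    qed (unfold w_def, rule pos)
    then show ?thesis using ends by simp
  qed
  have "u a b \<le> w 0"
  proof (cases "even a")
    case True
    then obtain i where i: "a = i + i" by (metis evenE mult_2)
    then have "b = (m - i) + (m - i)" "i \<le> m" using assms(6) by auto
    then show ?thesis using w[of i] i by (simp add: w_def)
  next
    case False
    then obtain i where i: "a = i + Suc i" by (metis oddE mult_2 add_Suc_right Suc_eq_plus1)
    with assms(6) have im: "Suc i \<le> m" by simp
    then obtain k where k: "m = Suc i + k" using le_Suc_ex by blast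
    have b: "b = Suc k + k" using assms(6) i k by simp
    \<comment> \<open>An odd exponent is no square in the inner product, but Cauchy-Schwarz bounds
      it by the geometric mean of its two even neighbours.\<close>
    have "(u a b)\<^sup>2 \<le> w i * w (Suc i)"
      using cs[of i "Suc i" "Suc k" k] i b k by (simp add: w_def)
    also have "\<dots> \<le> w 0 * w 0"
      using im by (intro mult_mono w) (simp, simp, unfold w_def, rule pos, rule pos)
    finally have "(u a b)\<^sup>2 \<le> (w 0)\<^sup>2" by (simp add: power2_eq_square)
    then show ?thesis by (rule power2_le_imp_le) (unfold w_def, rule pos)
  qed
  with w0 show ?thesis unfolding u_def by simp
qed

subsection \<open>Derivatives of trace powers along a line\<close>

definition has_mat_derivative :: "(real \<Rightarrow> complex mat) \<Rightarrow> complex mat \<Rightarrow> real \<Rightarrow> bool" where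
  "has_mat_derivative F F' t \<longleftrightarrow>
     (\<forall>i<d. \<forall>j<d. ((\<lambda>s. F s $$ (i, j)) has_vector_derivative F' $$ (i, j)) (at t))"

lemma has_mat_derivative_const: "has_mat_derivative (\<lambda>_. A) (0\<^sub>m d d) t"
  by (simp add: has_mat_derivative_def)

lemma has_mat_derivative_mult:
  assumes "\<And>t. F t \<in> M" "\<And>t. G t \<in> M" "F' \<in> M" "G' \<in> M"
    and "has_mat_derivative F F' t" "has_mat_derivative G G' t"
  shows "has_mat_derivative (\<lambda>s. F s * G s) (F' * G t + F t * G') t"
  unfolding has_mat_derivative_def
proof (intro allI impI)
  fix i j assume ij: "i < d" "j < d"
  have "((\<lambda>s. \<Sum>l<d. F s $$ (i, l) * G s $$ (l, j)) has_vector_derivative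
      (\<Sum>l<d. F t $$ (i, l) * G' $$ (l, j) + F' $$ (i, l) * G t $$ (l, j))) (at t)"
    using assms(5,6) ij unfolding has_mat_derivative_def
    by (intro has_vector_derivative_sum has_vector_derivative_mult) auto
  moreover have "(\<lambda>s. (F s * G s) $$ (i, j)) = (\<lambda>s. \<Sum>l<d. F s $$ (i, l) * G s $$ (l, j))"
    using ij by (intro ext mult_mat_index assms)
  moreover have "(F' * G t + F t * G') $$ (i, j) = (F' * G t) $$ (i, j) + (F t * G') $$ (i, j)"
    using ij carrier_matD[OF assms(1)[of t]] carrier_matD[OF assms(4)]
    by (intro index_add_mat) simp_all
  ultimately show "((\<lambda>s. (F s * G s) $$ (i, j)) has_vector_derivative
      (F' * G t + F t * G') $$ (i, j)) (at t)"
    using ij assms(3,4) mult_mat_index[OF assms(3) assms(2)[of t]] mult_mat_index[OF assms(1)[of t] assms(4)]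
    by (simp add: sum.distrib add.commute del: index_mult_mat)
qed

lemma has_derivative_Re_mtrace:
  assumes "\<And>t. F t \<in> M" "F' \<in> M" "has_mat_derivative F F' t"
  shows "((\<lambda>s. Re (mtrace (F s))) has_real_derivative Re (mtrace F')) (at t)"
proof -
  have "((\<lambda>s. \<Sum>i<d. F s $$ (i, i)) has_vector_derivative (\<Sum>i<d. F' $$ (i, i))) (at t)"
    using assms(3) unfolding has_mat_derivative_def by (intro has_vector_derivative_sum) auto
  from bounded_linear.has_vector_derivative[OF bounded_linear_Re this]
  show ?thesis
    using mtrace_carrier[OF assms(1)] mtrace_carrier[OF assms(2)]
    by (simp add: has_real_derivative_iff_has_vector_derivative)
qed

definition mat_line :: "complex mat \<Rightarrow> complex mat \<Rightarrow> real \<Rightarrow> complex mat" where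
  "mat_line H A t = H + complex_of_real t \<cdot>\<^sub>m A"

lemma mat_line_carrier [simp]: "H \<in> M \<Longrightarrow> A \<in> M \<Longrightarrow> mat_line H A t \<in> M"
  by (simp add: mat_line_def)

lemma hermitian_mat_line:
  assumes "H \<in> M" "A \<in> M" "hermitian H" "hermitian A"
  shows "hermitian (mat_line H A t)"
proof (rule hermitianI[of _ d])
  fix i j assume ij: "i < d" "j < d"
  have "X $$ (i, j) = cnj (X $$ (j, i))" if "X \<in> M" "hermitian X" for X
  proof -
    have "adjoint_mat X $$ (i, j) = cnj (X $$ (j, i))"
      using that(1) ij by (simp add: adjoint_mat_def)
    then show ?thesis unfolding that(2) .
  qed
  from this[OF assms(1,3)] this[OF assms(2,4)]
  show "mat_line H A t $$ (i, j) = cnj (mat_line H A t $$ (j, i))"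
    using assms(1,2) ij by (simp add: mat_line_def)
qed (use assms in simp)

lemma has_mat_derivative_mat_line:
  assumes "H \<in> M" "A \<in> M"
  shows "has_mat_derivative (mat_line H A) A t"
  unfolding has_mat_derivative_def
proof (intro allI impI)
  fix i j assume ij: "i < d" "j < d"
  have "((\<lambda>s. H $$ (i, j) + s *\<^sub>R A $$ (i, j)) has_vector_derivative A $$ (i, j)) (at t)"
    by (auto intro!: derivative_eq_intros simp: has_vector_derivative_def)
  moreover have "(\<lambda>s. mat_line H A s $$ (i, j)) = (\<lambda>s. H $$ (i, j) + s *\<^sub>R A $$ (i, j))"
    using assms ij by (simp add: mat_line_def scaleR_conv_of_real)
  ultimately show "((\<lambda>s. mat_line H A s $$ (i, j)) has_vector_derivative A $$ (i, j)) (at t)"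
    by simp
qed

text \<open>The directional derivative of the power, i.e. the sum of all
  \<open>L ^\<^sub>m a * A * L ^\<^sub>m (n - 1 - a)\<close>, kept in the recursive form that the
  product rule for \<open>L ^\<^sub>m n * L\<close> delivers.\<close>

primrec pow_deriv :: "complex mat \<Rightarrow> complex mat \<Rightarrow> nat \<Rightarrow> complex mat" where
  "pow_deriv L A 0 = 0\<^sub>m d d"
| "pow_deriv L A (Suc n) = pow_deriv L A n * L + L ^\<^sub>m n * A"

lemma pow_deriv_carrier [simp]: "L \<in> M \<Longrightarrow> A \<in> M \<Longrightarrow> pow_deriv L A n \<in> M"
  by (induction n) (auto intro!: add_carrier_mat mult_carrier_mat[of _ d d] pow_carrier_mat)

lemma has_mat_derivative_pow:
  assumes "H \<in> M" "A \<in> M"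
  shows "has_mat_derivative (\<lambda>t. mat_line H A t ^\<^sub>m n) (pow_deriv (mat_line H A t) A n) t"
proof (induction n)
  case 0
  have "(\<lambda>t. mat_line H A t ^\<^sub>m 0) = (\<lambda>t. 1\<^sub>m d)"
    using carrier_matD[OF mat_line_carrier[OF assms]] by simp
  then show ?case using has_mat_derivative_const[of "1\<^sub>m d"] by simp
next
  case (Suc n)
  show ?case
    using has_mat_derivative_mult[OF _ _ _ _ Suc has_mat_derivative_mat_line[OF assms]] assms
    by simp
qed

text \<open>The free factor \<open>X\<close> lets the induction absorb the trailing \<open>L\<close>
  into \<open>L * X\<close>. The case of the identity gives first derivatives of trace powers, the
  case \<open>X = A\<close> second ones.\<close>

lemma mtrace_pow_deriv:
  assumes "L \<in> M" "A \<in> M" "X \<in> M"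
  shows "mtrace (pow_deriv L A n * X) = (\<Sum>a<n. mtrace (L ^\<^sub>m a * (A * (L ^\<^sub>m (n - 1 - a) * X))))"
  using assms(3)
proof (induction n arbitrary: X)
  case 0
  then show ?case by (simp add: mtrace_def)
next
  case (Suc n)
  note [simp] = assms(1,2) Suc.prems mult_square_mat pow_carrier_mat[OF assms(1)]
  have "mtrace (pow_deriv L A (Suc n) * X) =
      mtrace (pow_deriv L A n * (L * X)) + mtrace (L ^\<^sub>m n * (A * X))"
    by (simp add: add_mult_distrib_mat[of _ d d _ _ d] mtrace_add assoc_square_mat)
  also have "mtrace (pow_deriv L A n * (L * X)) =
      (\<Sum>a<n. mtrace (L ^\<^sub>m a * (A * (L ^\<^sub>m (n - 1 - a) * (L * X)))))"
    by (rule Suc.IH) simp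
  also have "\<dots> = (\<Sum>a<n. mtrace (L ^\<^sub>m a * (A * (L ^\<^sub>m (n - a) * X))))"
  proof (rule sum.cong[OF refl])
    fix a assume "a \<in> {..<n}"
    then have "n - a = Suc (n - 1 - a)" by simp
    then have "L ^\<^sub>m (n - a) = L ^\<^sub>m (n - 1 - a) * L" by simp
    then show "mtrace (L ^\<^sub>m a * (A * (L ^\<^sub>m (n - 1 - a) * (L * X)))) =
        mtrace (L ^\<^sub>m a * (A * (L ^\<^sub>m (n - a) * X)))"
      by (simp add: assoc_square_mat)
  qed
  finally show ?case by (simp add: left_mult_one_mat[of _ d d] carrier_matD[OF assms(1)])
qed

text \<open>Under the trace all n + 1 terms of the noncommutative product rule coincide by
  cyclicity, which leaves the scalar power rule.\<close>

lemma has_derivative_trace_pow: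
  assumes "H \<in> M" "A \<in> M"
  shows "((\<lambda>t. Re (mtrace (mat_line H A t ^\<^sub>m Suc n))) has_real_derivative
    Suc n * Re (mtrace (mat_line H A t ^\<^sub>m n * A))) (at t)"
proof -
  define L where "L = mat_line H A t"
  have L [simp]: "L \<in> M" using assms by (simp add: L_def)
  note [simp] = assms mult_square_mat pow_carrier_mat[OF L] right_mult_one_mat[of _ d d] carrier_matD[OF L]
  have "mtrace (pow_deriv L A (Suc n)) = mtrace (pow_deriv L A (Suc n) * 1\<^sub>m d)"
    using right_mult_one_mat[of "pow_deriv L A (Suc n)" d d] by (simp del: pow_deriv.simps)
  also have "\<dots> = (\<Sum>a<Suc n. mtrace (L ^\<^sub>m a * (A * L ^\<^sub>m (n - a))))"
    unfolding mtrace_pow_deriv[OF L assms(2) one_carrier_mat] by simp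
  also have "\<dots> = (\<Sum>a<Suc n. mtrace (L ^\<^sub>m n * A))"
  proof (rule sum.cong[OF refl])
    fix a assume "a \<in> {..<Suc n}"
    then have n: "n - a + a = n" by simp
    have "mtrace (L ^\<^sub>m a * (A * L ^\<^sub>m (n - a))) = mtrace (A * L ^\<^sub>m (n - a) * L ^\<^sub>m a)"
      by (rule mtrace_mult_comm) simp_all
    also have "\<dots> = mtrace (A * L ^\<^sub>m n)"
      using pow_mat_add[OF L, of "n - a" a, unfolded n] by (simp add: assoc_square_mat)
    also have "\<dots> = mtrace (L ^\<^sub>m n * A)" by (rule mtrace_mult_comm) simp_all
    finally show "mtrace (L ^\<^sub>m a * (A * L ^\<^sub>m (n - a))) = mtrace (L ^\<^sub>m n * A)" .
  qed
  finally have "Re (mtrace (pow_deriv L A (Suc n))) = Suc n * Re (mtrace (L ^\<^sub>m n * A))"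
    by simp
  moreover have "((\<lambda>t. Re (mtrace (mat_line H A t ^\<^sub>m Suc n))) has_real_derivative
      Re (mtrace (pow_deriv L A (Suc n)))) (at t)"
    unfolding L_def
    by (rule has_derivative_Re_mtrace) (use assms has_mat_derivative_pow in \<open>simp_all del: pow_mat.simps pow_deriv.simps add: pow_carrier_mat[OF mat_line_carrier]\<close>)
  ultimately show ?thesis by (simp only: L_def)
qed

lemma has_derivative_trace_pow_mult:
  assumes "H \<in> M" "A \<in> M"
  shows "((\<lambda>t. Re (mtrace (mat_line H A t ^\<^sub>m n * A))) has_real_derivative
    Re (mtrace (pow_deriv (mat_line H A t) A n * A))) (at t)"
proof (rule has_derivative_Re_mtrace)
  let ?D = "pow_deriv (mat_line H A t) A n"
  have "has_mat_derivative (\<lambda>t. mat_line H A t ^\<^sub>m n * A)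
      (?D * A + mat_line H A t ^\<^sub>m n * 0\<^sub>m d d) t"
    by (rule has_mat_derivative_mult[OF _ _ _ _ has_mat_derivative_pow[OF assms] has_mat_derivative_const])
      (use assms in simp_all)
  moreover have "?D * A + mat_line H A t ^\<^sub>m n * 0\<^sub>m d d = ?D * A"
    using assms right_mult_zero_mat[of "mat_line H A t ^\<^sub>m n" d d d]
      right_add_zero_mat[of "?D * A" d d]
    by (simp add: mult_square_mat)
  ultimately show "has_mat_derivative (\<lambda>t. mat_line H A t ^\<^sub>m n * A) (?D * A) t"
    by simp
qed (use assms in \<open>simp_all add: mult_square_mat\<close>)

text \<open>Together with the factor 2q + 2 of the first derivative, this bounds the second
  derivative of the trace of L^(2q+2) by (2q+2)(2q+1) times the trace of L^(2q), just as for
  commuting matrices: every term has the form treated in \<open>trace_sandwich_le\<close>.\<close>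

lemma trace_pow_second_derivative_le:
  assumes "L \<in> M" "A \<in> M" "hermitian L" "hermitian A" "hs_contraction A"
  shows "Re (mtrace (pow_deriv L A (Suc (2 * q)) * A)) \<le> Suc (2 * q) * Re (mtrace (L ^\<^sub>m (2 * q)))"
proof -
  have "Re (mtrace (pow_deriv L A (Suc (2 * q)) * A)) =
      (\<Sum>a<Suc (2 * q). Re (mtrace (L ^\<^sub>m a * (A * (L ^\<^sub>m (2 * q - a) * A)))))"
    unfolding mtrace_pow_deriv[OF assms(1,2,2)] Re_sum by simp
  also have "\<dots> \<le> (\<Sum>a<Suc (2 * q). Re (mtrace (L ^\<^sub>m (2 * q))))"
    by (intro sum_mono trace_sandwich_le[OF assms]) auto
  finally show ?thesis by simp
qed

text \<open>A truncation of the trace of \<open>cosh (s H)\<close>.\<close>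
definition cosh_potential :: "real \<Rightarrow> nat \<Rightarrow> complex mat \<Rightarrow> real" where
  "cosh_potential s p H = (\<Sum>q\<le>p. s ^ (2 * q) / fact (2 * q) * Re (mtrace (H ^\<^sub>m (2 * q))))"

text \<open>Along the line H + tA the coefficients turn the bound on second derivatives of trace
  powers into \<phi>'' \<le> s^2 \<phi>, so \<open>cosh_comparison\<close> applies at t = 1 and t =
  -1.\<close>

lemma cosh_potential_step:
  assumes "H \<in> M" "A \<in> M" "hermitian H" "hermitian A" "hs_contraction A"
  shows "cosh_potential s p (H + A) + cosh_potential s p (H - A) \<le> 2 * cosh s * cosh_potential s p H"
proof -
  define \<phi> where "\<phi> t = cosh_potential s p (mat_line H A t)" for t
  define c where "c q = s ^ (2 * q) / fact (2 * q)" for q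
  have c: "c q \<ge> 0" for q by (simp add: c_def)
  define \<phi>' where "\<phi>' t = (\<Sum>q<p. c (Suc q) *
      (real (2 * Suc q) * Re (mtrace (mat_line H A t ^\<^sub>m Suc (2 * q) * A))))" for t
  define \<phi>'' where "\<phi>'' t = (\<Sum>q<p. c (Suc q) *
      (real (2 * Suc q) * Re (mtrace (pow_deriv (mat_line H A t) A (Suc (2 * q)) * A))))" for t
  have split: "\<phi> t = c 0 * Re (mtrace (1\<^sub>m d)) +
      (\<Sum>q<p. c (Suc q) * Re (mtrace (mat_line H A t ^\<^sub>m Suc (Suc (2 * q)))))" for t
  proof -
    have "\<phi> t = (\<Sum>q<Suc p. c q * Re (mtrace (mat_line H A t ^\<^sub>m (2 * q))))"
      by (simp only: \<phi>_def cosh_potential_def c_def lessThan_Suc_atMost)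
    also have "\<dots> = c 0 * Re (mtrace (1\<^sub>m d)) +
      (\<Sum>q<p. c (Suc q) * Re (mtrace (mat_line H A t ^\<^sub>m (2 * Suc q))))"
      unfolding sum.lessThan_Suc_shift using carrier_matD[OF mat_line_carrier[OF assms(1,2), of t]]
      by simp
    finally show ?thesis by (simp only: mult_Suc_right add_2_eq_Suc)
  qed
  have "(\<phi> has_real_derivative \<phi>' t) (at t)" for t
  proof -
    have "((\<lambda>t. c 0 * Re (mtrace (1\<^sub>m d)) +
        (\<Sum>q<p. c (Suc q) * Re (mtrace (mat_line H A t ^\<^sub>m Suc (Suc (2 * q)))))) has_real_derivative
        0 + (\<Sum>q<p. c (Suc q) * (real (Suc (Suc (2 * q))) * Re (mtrace (mat_line H A t ^\<^sub>m Suc (2 * q) * A))))) (at t)"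
      by (intro DERIV_add DERIV_const DERIV_sum DERIV_cmult has_derivative_trace_pow assms)
    then show ?thesis unfolding \<phi>'_def split[abs_def] by simp
  qed
  moreover have "(\<phi>' has_real_derivative \<phi>'' t) (at t)" for t
    unfolding \<phi>'_def \<phi>''_def
    by (intro DERIV_sum DERIV_cmult has_derivative_trace_pow_mult assms)
  moreover have "\<phi>'' t \<le> s\<^sup>2 * \<phi> t" for t
  proof -
    let ?L = "mat_line H A t"
    have L: "?L \<in> M" "hermitian ?L" using assms hermitian_mat_line by auto
    have "\<phi>'' t \<le> (\<Sum>q<p. c (Suc q) * (real (2 * Suc q) * (Suc (2 * q) * Re (mtrace (?L ^\<^sub>m (2 * q))))))"
      unfolding \<phi>''_def
      by (intro sum_mono mult_left_mono trace_pow_second_derivative_le assms L c) simp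
    also have "\<dots> = s\<^sup>2 * (\<Sum>q<p. c q * Re (mtrace (?L ^\<^sub>m (2 * q))))"
      unfolding sum_distrib_left
    proof (rule sum.cong[OF refl])
      fix q
      have "(fact (2 * Suc q) :: real) = real (2 * Suc q) * real (Suc (2 * q)) * fact (2 * q)"
        by (simp add: algebra_simps)
      then have "c (Suc q) * (real (2 * Suc q) * real (Suc (2 * q))) = s\<^sup>2 * c q"
        by (simp only: c_def) (simp add: power2_eq_square del: fact_Suc of_nat_Suc)
      then show "c (Suc q) * (real (2 * Suc q) * (Suc (2 * q) * Re (mtrace (?L ^\<^sub>m (2 * q))))) =
          s\<^sup>2 * (c q * Re (mtrace (?L ^\<^sub>m (2 * q))))"
        by (simp only: mult.assoc[symmetric])
    qed
    \<comment> \<open>Differentiating twice shifts the series down by one index, so the top term is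
      missing; it is nonnegative and may be added back.\<close>
    also have "\<dots> \<le> s\<^sup>2 * (\<Sum>q\<le>p. c q * Re (mtrace (?L ^\<^sub>m (2 * q))))"
      by (intro mult_left_mono sum_mono2 mult_nonneg_nonneg c trace_even_pow_nonneg[OF L]) auto
    finally show ?thesis by (simp add: \<phi>_def cosh_potential_def c_def)
  qed
  ultimately have "\<phi> 1 + \<phi> (- 1) \<le> 2 * cosh s * \<phi> 0" by (rule cosh_comparison)
  moreover have "mat_line H A 1 = H + A" "mat_line H A 0 = H" "mat_line H A (- 1) = H - A"
    using assms(1,2) by (auto simp: mat_line_def intro!: eq_matI)
  ultimately show ?thesis by (simp add: \<phi>_def)
qed

end

subsection \<open>States and measurements\<close>

lemma psd_quadratic_nonneg:
  assumes "psd P" "P \<in> carrier_mat d d" "v \<in> carrier_vec d"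
  shows "0 \<le> Re (\<Sum>i<d. \<Sum>j<d. cnj (vec_index v i) * P $$ (i, j) * vec_index v j)"
proof -
  have "dim_row P = d" using assms(2) by simp
  note quadratic = assms(1)[unfolded psd_def this, THEN conjunct2, THEN conjunct2]
  show ?thesis by (rule bspec[OF quadratic assms(3)])
qed

text \<open>The trace is the sum of the quadratic form of \<open>P\<close> over the columns of
  \<open>X\<close>.\<close>

lemma psd_sandwich_nonneg:
  assumes "psd P" "P \<in> carrier_mat d d" "X \<in> carrier_mat d d"
  shows "0 \<le> Re (mtrace (adjoint_mat X * (P * X)))"
proof -
  note [simp] = adjoint_mat_carrier[OF assms(3)] mult_square_mat[of _ d]
  have dim: "dim_row P = d" "dim_row X = d" "dim_col X = d" using assms by auto
  have "mtrace (adjoint_mat X * (P * X)) = (\<Sum>i<d. (adjoint_mat X * (P * X)) $$ (i, i))"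
    by (rule mtrace_carrier) (use assms in simp)
  also have "\<dots> = (\<Sum>i<d. \<Sum>a<d. \<Sum>b<d. cnj (vec_index (col X i) a) * P $$ (a, b) * vec_index (col X i) b)"
  proof (rule sum.cong[OF refl])
    fix i assume i: "i \<in> {..<d}"
    have "(adjoint_mat X * (P * X)) $$ (i, i) = (\<Sum>a<d. adjoint_mat X $$ (i, a) * (P * X) $$ (a, i))"
      by (rule mult_mat_index) (use assms i in simp_all)
    also have "\<dots> = (\<Sum>a<d. cnj (vec_index (col X i) a) * (\<Sum>b<d. P $$ (a, b) * vec_index (col X i) b))"
    proof (rule sum.cong[OF refl])
      fix a assume a: "a \<in> {..<d}"
      have "adjoint_mat X $$ (i, a) = cnj (vec_index (col X i) a)"
        using i a dim by (simp add: adjoint_mat_def)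
      moreover have "(P * X) $$ (a, i) = (\<Sum>b<d. P $$ (a, b) * X $$ (b, i))"
        by (rule mult_mat_index) (use assms i a in simp_all)
      then have "(P * X) $$ (a, i) = (\<Sum>b<d. P $$ (a, b) * vec_index (col X i) b)"
        using i dim by simp
      ultimately show "adjoint_mat X $$ (i, a) * (P * X) $$ (a, i) =
          cnj (vec_index (col X i) a) * (\<Sum>b<d. P $$ (a, b) * vec_index (col X i) b)" by simp
    qed
    finally show "(adjoint_mat X * (P * X)) $$ (i, i) = (\<Sum>a<d. \<Sum>b<d.
        cnj (vec_index (col X i) a) * P $$ (a, b) * vec_index (col X i) b)"
      by (simp only: sum_distrib_left mult.assoc)
  qed
  finally have eq: "mtrace (adjoint_mat X * (P * X)) = (\<Sum>i<d. \<Sum>a<d. \<Sum>b<d.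
      cnj (vec_index (col X i) a) * P $$ (a, b) * vec_index (col X i) b)" .
  have "0 \<le> Re (\<Sum>a<d. \<Sum>b<d. cnj (vec_index (col X i) a) * P $$ (a, b) * vec_index (col X i) b)" for i
  proof (rule psd_quadratic_nonneg[OF assms(1,2)])
    show "col X i \<in> carrier_vec d" using col_dim[of X i] unfolding dim .
  qed
  then show ?thesis
    unfolding eq Re_sum[of "\<lambda>i. \<Sum>a<d. \<Sum>b<d. cnj (vec_index (col X i) a) * P $$ (a, b) * vec_index (col X i) b"]
    by (rule sum_nonneg)
qed

lemma psd_index_cnj:
  "psd P \<Longrightarrow> P \<in> carrier_mat d d \<Longrightarrow> i < d \<Longrightarrow> j < d \<Longrightarrow> P $$ (i, j) = cnj (P $$ (j, i))"
  using carrier_matD(1)[of P d d] unfolding psd_def by fast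

lemma psd_hermitian: "psd P \<Longrightarrow> P \<in> carrier_mat d d \<Longrightarrow> hermitian P"
  by (rule hermitianI[of _ d]) (auto intro: psd_index_cnj)

lemma mat_add_diff_cancel:
  fixes U V :: "'a :: ab_group_add mat"
  shows "U \<in> carrier_mat n m \<Longrightarrow> V \<in> carrier_mat n m \<Longrightarrow> U + (V - U) = V"
  by (rule eq_matI) auto

lemma hs_inner_polarization:
  assumes "U \<in> carrier_mat d d" "V \<in> carrier_mat d d"
  shows "hs_inner (U + V) (U + V) - hs_inner (U - V) (U - V) = 4 * hs_inner U V"
proof -
  have c: "U + V \<in> carrier_mat d d" "U - V \<in> carrier_mat d d" using assms by auto
  have dim: "dim_row V = d" "dim_col V = d" using assms by auto
  show ?thesis
    unfolding hs_inner_sum[OF c(1,1)] hs_inner_sum[OF c(2,2)] hs_inner_sum[OF assms]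
      sum_subtractf[symmetric] sum_distrib_left
  proof (rule sum.cong[OF refl], clarify)
    fix i j assume "i < d" "j < d"
    then show "Re (cnj ((U + V) $$ (j, i)) * (U + V) $$ (j, i)) -
        Re (cnj ((U - V) $$ (j, i)) * (U - V) $$ (j, i)) = 4 * Re (cnj (U $$ (j, i)) * V $$ (j, i))"
      by (simp add: dim algebra_simps)
  qed
qed

text \<open>With Q = I - P, polarization gives |X|^2 - |(P - Q)X|^2 = 4 <PX, QX>. The right-hand
  side is nonnegative: P and Q commute and sum to I, so PQ = PQP + QPQ, and each summand is a psd
  matrix conjugated by a Hermitian one.\<close>

lemma hs_contraction_measurement:
  assumes "P \<in> carrier_mat d d" "psd P" "psd (1\<^sub>m d - P)"
  shows "hs_contraction d (P - (1\<^sub>m d - P))"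
  unfolding hs_contraction_def
proof
  fix X :: "complex mat" assume X: "X \<in> carrier_mat d d"
  define Q where "Q = 1\<^sub>m d - P"
  have Q: "Q \<in> carrier_mat d d" "psd Q" using assms by (simp_all add: Q_def minus_carrier_mat)
  note [simp] = assms(1,2) X Q mult_square_mat[of _ d] psd_hermitian[of _ d]
  have QY: "Q * Y = Y - P * Y" if "Y \<in> carrier_mat d d" for Y
    unfolding Q_def using that
    by (simp add: minus_mult_distrib_mat[of _ d d _ _ d] left_mult_one_mat[of _ d d])
  have PQ: "P * Q = Q * P"
    unfolding QY[OF assms(1)] unfolding Q_def
    by (simp add: mult_minus_distrib_mat[of _ d d _ d] right_mult_one_mat[of _ d d])
  have split: "P * (Q * P) + Q * (P * Q) = P * Q"
    unfolding QY[OF mult_square_mat[OF assms(1) Q(1)]] PQ[symmetric]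
    by (rule mat_add_diff_cancel[of _ d d]) simp_all
  have "hs_inner (P * X) (Q * X) = Re (mtrace (adjoint_mat X * (P * Q * X)))"
    using assms(1) X unfolding hs_inner_def
    by (simp add: adjoint_mat_mult[of _ d d _ d] assoc_square_mat[of _ d])
  also have "P * Q * X = (P * (Q * P) + Q * (P * Q)) * X"
    by (simp only: split)
  also have "\<dots> = P * (Q * P) * X + Q * (P * Q) * X"
    by (rule add_mult_distrib_mat[of _ d d _ _ d]) simp_all
  also have "adjoint_mat X * \<dots> = adjoint_mat (P * X) * (Q * (P * X)) + adjoint_mat (Q * X) * (P * (Q * X))"
    by (simp add: adjoint_mat_mult[of _ d d _ d] assoc_square_mat[of _ d] mult_add_distrib_mat[of _ d d _ d])
  also have "mtrace \<dots> = mtrace (adjoint_mat (P * X) * (Q * (P * X))) + mtrace (adjoint_mat (Q * X) * (P * (Q * X)))"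
    by (rule mtrace_add[of _ d]) simp_all
  finally have "0 \<le> hs_inner (P * X) (Q * X)"
    using psd_sandwich_nonneg[of Q d "P * X"] psd_sandwich_nonneg[of P d "Q * X"] by simp
  moreover have "P * X + Q * X = X"
    unfolding QY[OF X] by (rule mat_add_diff_cancel[of _ d d]) simp_all
  moreover have "(P - Q) * X = P * X - Q * X"
    by (rule minus_mult_distrib_mat[of _ d d _ _ d]) simp_all
  ultimately show "hs_inner ((P - (1\<^sub>m d - P)) * X) ((P - (1\<^sub>m d - P)) * X) \<le> hs_inner X X"
    using hs_inner_polarization[of "P * X" d "Q * X"] by (simp flip: Q_def)
qed

text \<open>The variance of an observable is nonnegative: expand the trace of K \<rho> K for K = H -
  cI, where c is the expectation of H.\<close>

lemma density_Cauchy_Schwarz: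
  assumes "H \<in> carrier_mat d d" "hermitian H" "psd \<rho>" "\<rho> \<in> carrier_mat d d" "mtrace \<rho> = 1"
  shows "(Re (mtrace (H * \<rho>)))\<^sup>2 \<le> Re (mtrace (H * H * \<rho>))"
proof -
  define c where "c = Re (mtrace (H * \<rho>))"
  define K where "K = mat_line H (1\<^sub>m d) (- c)"
  note [simp] = assms mult_square_mat[of _ d]
  have K [simp]: "K \<in> carrier_mat d d" by (simp add: K_def mat_line_carrier[of _ d])
  have "hermitian K" unfolding K_def by (rule hermitian_mat_line[of _ d]) simp_all
  then have "0 \<le> Re (mtrace (K * (\<rho> * K)))"
    using psd_sandwich_nonneg[of \<rho> d K] by simp
  also have "mtrace (K * (\<rho> * K)) = mtrace (K * (K * \<rho>))"
    using mtrace_mult_comm[of "K * \<rho>" d K] by (simp add: assoc_square_mat[of _ d])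
  also have KX: "K * X = H * X + complex_of_real (- c) \<cdot>\<^sub>m X" if "X \<in> carrier_mat d d" for X
    unfolding K_def mat_line_def using that
    by (simp add: add_mult_distrib_mat[of _ d d _ _ d] mult_smult_assoc_mat[of _ d d _ d] left_mult_one_mat[of _ d d])
  have "mtrace (K * X) = mtrace (H * X) - c * mtrace X" if "X \<in> carrier_mat d d" for X
    unfolding KX[OF that] using that by (simp add: mtrace_add[of _ d] mtrace_smult[of _ d])
  then have "mtrace (K * (K * \<rho>)) = mtrace (H * (K * \<rho>)) - c * (mtrace (H * \<rho>) - c)"
    by simp
  also have "mtrace (H * (K * \<rho>)) = mtrace (H * (H * \<rho>)) - c * mtrace (H * \<rho>)"
    unfolding KX[OF assms(4)]
    by (simp add: mult_add_distrib_mat[of _ d d _ d] mult_smult_distrib[of _ d d _ d] mtrace_add[of _ d] mtrace_smult[of _ d])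
  finally show ?thesis
    by (simp add: c_def[symmetric] power2_eq_square assoc_square_mat[of _ d])
qed

lemma psd_quadratic_two:
  assumes "psd P" "P \<in> carrier_mat d d" "i < d" "j < d" "i \<noteq> j"
  shows "0 \<le> Re (P $$ (i, i) + cnj w * P $$ (j, i) + P $$ (i, j) * w + cnj w * P $$ (j, j) * w)"
proof -
  define u where "u l = (if l = i then 1 else 0) + (if l = j then w else 0)" for l
  define v where "v = Matrix.vec d u"
  have v: "v \<in> carrier_vec d" by (simp add: v_def)
  have "0 \<le> Re (\<Sum>a<d. \<Sum>b<d. cnj (vec_index v a) * P $$ (a, b) * vec_index v b)"
    by (rule psd_quadratic_nonneg[OF assms(1,2) v])
  also have "(\<Sum>a<d. \<Sum>b<d. cnj (vec_index v a) * P $$ (a, b) * vec_index v b) =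
     (\<Sum>a<d. cnj (u a) * (\<Sum>b<d. P $$ (a, b) * u b))"
    by (simp add: v_def sum_distrib_left mult.assoc)
  also have "\<dots> = (\<Sum>a<d. cnj (u a) * (P $$ (a, i) + P $$ (a, j) * w))"
  proof -
    have "(\<Sum>b<d. P $$ (a, b) * u b) = (\<Sum>b<d. if b = i then P $$ (a, b) else 0) +
        (\<Sum>b<d. if b = j then P $$ (a, b) * w else 0)" for a
      unfolding sum.distrib[symmetric] u_def by (intro sum.cong refl) (simp add: algebra_simps)
    then show ?thesis using assms by simp
  qed
  also have "\<dots> = (\<Sum>a<d. if a = i then P $$ (a, i) + P $$ (a, j) * w else 0) +
      (\<Sum>a<d. if a = j then cnj w * (P $$ (a, i) + P $$ (a, j) * w) else 0)"
    unfolding sum.distrib[symmetric] u_def by (intro sum.cong refl) (simp add: algebra_simps)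
  also have "\<dots> = P $$ (i, i) + P $$ (i, j) * w + cnj w * (P $$ (j, i) + P $$ (j, j) * w)"
    using assms by simp
  finally show ?thesis by (simp add: algebra_simps)
qed

text \<open>Diagonal entries are nonnegative and sum to 1. For an off-diagonal entry z, the
  quadratic form at e_i + w e_j is used with the phase w that makes both cross terms equal to -|z|;
  this gives 2|z| \<le> \<rho>_ii + \<rho>_jj \<le> 2.\<close>

lemma density_entry_le_one:
  assumes "psd \<rho>" "\<rho> \<in> carrier_mat d d" "mtrace \<rho> = 1" "i < d" "j < d"
  shows "cmod (\<rho> $$ (i, j)) \<le> 1"
proof -
  have herm: "\<rho> $$ (a, b) = cnj (\<rho> $$ (b, a))" if "a < d" "b < d" for a b
    by (rule psd_index_cnj[OF assms(1,2) that])
  have real: "\<rho> $$ (a, a) = of_real (Re (\<rho> $$ (a, a)))" if "a < d" for a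
    using herm[OF that that] by (simp add: complex_eq_iff)
  have pos: "Re (\<rho> $$ (a, a)) \<ge> 0" if a: "a < d" for a
  proof -
    define v :: "complex Matrix.vec" where "v = Matrix.vec d (\<lambda>l. if l = a then 1 else 0)"
    have v: "v \<in> carrier_vec d" by (simp add: v_def)
    have "0 \<le> Re (\<Sum>i<d. \<Sum>j<d. cnj (vec_index v i) * \<rho> $$ (i, j) * vec_index v j)"
      by (rule psd_quadratic_nonneg[OF assms(1,2) v])
    also have "(\<Sum>i<d. \<Sum>j<d. cnj (vec_index v i) * \<rho> $$ (i, j) * vec_index v j) =
        (\<Sum>i<d. \<Sum>j<d. if j = a then (if i = a then \<rho> $$ (i, j) else 0) else 0)"
      by (intro sum.cong refl) (simp add: v_def)
    finally show ?thesis using a by simp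
  qed
  have sum: "(\<Sum>a<d. Re (\<rho> $$ (a, a))) = 1"
    using assms(3) unfolding mtrace_carrier[OF assms(2)] by (metis Re_sum one_complex.sel(1))
  have diag: "Re (\<rho> $$ (a, a)) \<le> 1" if "a < d" for a
    using member_le_sum[of a "{..<d}" "\<lambda>a. Re (\<rho> $$ (a, a))"] pos that sum by auto
  show ?thesis
  proof (cases "i = j")
    case True
    then show ?thesis
      using real[OF assms(4)] pos[OF assms(4)] diag[OF assms(4)]
      by (metis abs_of_nonneg norm_of_real)
  next
    case False
    define z where "z = \<rho> $$ (i, j)"
    define w where "w = - cnj z / cmod z"
    show ?thesis
    proof (cases "z = 0")
      case nz: False
      have w: "z * w = - of_real (cmod z)" "cnj w * w = 1"
        using nz complex_norm_square[of z] by (simp_all add: w_def power2_eq_square field_simps)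
      have "0 \<le> Re (\<rho> $$ (i, i) + cnj w * \<rho> $$ (j, i) + z * w + cnj w * \<rho> $$ (j, j) * w)"
        unfolding z_def by (rule psd_quadratic_two) fact+
      also have "cnj w * \<rho> $$ (j, i) = cnj (z * w)"
        using herm[OF assms(5,4)] by (simp add: z_def)
      also have "cnj w * \<rho> $$ (j, j) * w = \<rho> $$ (j, j)"
        using w(2) by (metis mult.assoc mult.commute mult_1)
      finally have "2 * cmod z \<le> Re (\<rho> $$ (i, i)) + Re (\<rho> $$ (j, j))"
        unfolding w(1) by simp
      then show ?thesis using diag[OF assms(4)] diag[OF assms(5)] by (simp add: z_def)
    qed (simp add: z_def)
  qed
qed

text \<open>Iterating \<open>density_Cauchy_Schwarz\<close> doubles the exponent, hence the powers
  of two. A last Hilbert-Schmidt Cauchy-Schwarz step separates the state from the power of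
  \<open>H\<close>.\<close>

lemma expectation_pow_le_trace_pow:
  assumes H: "H \<in> carrier_mat d d" "hermitian H"
    and \<rho>: "psd \<rho>" "\<rho> \<in> carrier_mat d d" "mtrace \<rho> = 1"
    and nonneg: "0 \<le> Re (mtrace (H * \<rho>))"
  shows "Re (mtrace (H * \<rho>)) ^ (2 * 2 ^ r) \<le> (real d)\<^sup>2 * Re (mtrace (H ^\<^sub>m (2 * 2 ^ r)))"
proof -
  let ?a = "\<lambda>r. Re (mtrace (H ^\<^sub>m (2 ^ r) * \<rho>))"
  have pow: "Re (mtrace (H * \<rho>)) ^ (2 ^ r) \<le> ?a r"
  proof (induction r)
    case 0
    then show ?case using H by (simp add: left_mult_one_mat[of _ d d] carrier_matD)
  next
    case (Suc r)
    have "Re (mtrace (H * \<rho>)) ^ (2 ^ Suc r) = (Re (mtrace (H * \<rho>)) ^ (2 ^ r))\<^sup>2"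
      by (simp add: power_mult[symmetric] mult.commute)
    also have "\<dots> \<le> (?a r)\<^sup>2" using Suc nonneg by (intro power_mono) auto
    also have "\<dots> \<le> Re (mtrace (H ^\<^sub>m (2 ^ r) * H ^\<^sub>m (2 ^ r) * \<rho>))"
      by (rule density_Cauchy_Schwarz[of _ d]) (use H \<rho> in \<open>auto simp: hermitian_pow[of _ d]\<close>)
    also have "\<dots> = ?a (Suc r)" using pow_mat_add[OF H(1), of "2 ^ r" "2 ^ r"] by (simp add: mult_2)
    finally show ?case .
  qed
  have a: "?a r = hs_inner (H ^\<^sub>m (2 ^ r)) \<rho>"
    unfolding hs_inner_def hermitian_pow[OF H] ..
  have "Re (mtrace (H * \<rho>)) ^ (2 * 2 ^ r) = (Re (mtrace (H * \<rho>)) ^ (2 ^ r))\<^sup>2"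
    by (simp add: power_mult[symmetric] mult.commute)
  also have "\<dots> \<le> (?a r)\<^sup>2" using pow nonneg by (intro power_mono) auto
  also have "\<dots> \<le> hs_inner (H ^\<^sub>m (2 ^ r)) (H ^\<^sub>m (2 ^ r)) * hs_inner \<rho> \<rho>"
    unfolding a by (rule hs_inner_Cauchy_Schwarz[of _ d]) (use H \<rho> in auto)
  also have "hs_inner (H ^\<^sub>m (2 ^ r)) (H ^\<^sub>m (2 ^ r)) = Re (mtrace (H ^\<^sub>m (2 * 2 ^ r)))"
    by (rule trace_even_pow[OF H, symmetric])
  \<comment> \<open>The entrywise bound yields the crude factor d^2; for d = 2^k this only changes
    the constant in front of k.\<close>
  also have "hs_inner \<rho> \<rho> \<le> (\<Sum>(i, j)\<in>{..<d} \<times> {..<d}. 1)"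
    unfolding hs_inner_self_sum[OF \<rho>(2)]
    by (rule sum_mono) (auto intro!: power_le_one density_entry_le_one[OF \<rho>])
  then have "Re (mtrace (H ^\<^sub>m (2 * 2 ^ r))) * hs_inner \<rho> \<rho> \<le> Re (mtrace (H ^\<^sub>m (2 * 2 ^ r))) * (real d)\<^sup>2"
    by (intro mult_left_mono trace_even_pow_nonneg[OF H]) (simp add: power2_eq_square)
  finally show ?thesis by (simp add: mult.commute)
qed

subsection \<open>Mistake trees of quantum protocols\<close>

context
  fixes Z :: "(bool list \<times> bool list) set" and f :: "bool list \<Rightarrow> bool list \<Rightarrow> bool"
    and k :: nat and \<rho> E :: "bool list \<Rightarrow> complex mat"
  assumes density: "\<And>x. density_mat k (\<rho> x)"
    and povm: "\<And>y. povm_elem k (E y)"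
    and correct: "\<And>x y. (x, y) \<in> Z \<Longrightarrow>
      Re (mtrace ((if f x y then E y else 1\<^sub>m (2 ^ k) - E y) * \<rho> x)) \<ge> 2 / 3"
begin

text \<open>The potentials of the two children sum to at most 2 cosh s times the current one, so the
  branch with the smaller potential grows by at most cosh s. The branches are chosen before
  \<open>x\<close> is known: whichever \<open>x\<close> survives at the leaf gives the chosen
  answers, and its expectation gains 1/3 at every level.\<close>

lemma mistake_tree_hypothesis:
  assumes "mistake_tree Z f n X" "H \<in> carrier_mat (2 ^ k) (2 ^ k)" "hermitian H"
  shows "\<exists>x\<in>X. \<exists>H'\<in>carrier_mat (2 ^ k) (2 ^ k). hermitian H' \<and>
    Re (mtrace (H * \<rho> x)) + n / 3 \<le> Re (mtrace (H' * \<rho> x)) \<and>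
    cosh_potential s p H' \<le> cosh s ^ n * cosh_potential s p H"
  using assms
proof (induction n arbitrary: X H)
  case 0
  then show ?case by auto
next
  case (Suc n)
  let ?d = "2 ^ k :: nat"
  note H = Suc.prems(2,3)
  from Suc.prems(1) obtain y where
    y: "\<And>b. mistake_tree Z f n {x \<in> X. (x, y) \<in> Z \<and> f x y = b}" by auto
  define A where "A = E y - (1\<^sub>m ?d - E y)"
  have E: "E y \<in> carrier_mat ?d ?d" "psd (E y)" "psd (1\<^sub>m ?d - E y)"
    using povm[of y] by (auto simp: povm_elem_def)
  have Ec: "1\<^sub>m ?d - E y \<in> carrier_mat ?d ?d" using E(1) by (simp add: minus_carrier_mat)
  have A: "A \<in> carrier_mat ?d ?d" unfolding A_def using Ec by (simp add: minus_carrier_mat)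
  have hA: "hermitian A"
  proof (rule hermitianI[OF A])
    fix i j assume ij: "i < ?d" "j < ?d"
    have "X $$ (i, j) = cnj (X $$ (j, i))" if "psd X" "X \<in> carrier_mat ?d ?d" for X
      by (rule psd_index_cnj[OF that ij])
    from this[OF E(2,1)] this[OF E(3) Ec]
    show "A $$ (i, j) = cnj (A $$ (j, i))" unfolding A_def using E(1) ij by simp
  qed
  have \<rho>: "\<rho> x \<in> carrier_mat ?d ?d" "mtrace (\<rho> x) = 1" for x
    using density[of x] by (auto simp: density_mat_def)
  define S where "S b = (if b then H + A else H - A)" for b
  have S: "S b \<in> carrier_mat ?d ?d" "hermitian (S b)" for b
  proof -
    have "mat_line H A 1 = H + A" "mat_line H A (- 1) = H - A"
      using A H(1) by (auto simp: mat_line_def intro!: eq_matI)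
    then have "S b = mat_line H A (if b then 1 else - 1)" by (simp add: S_def)
    then show "S b \<in> carrier_mat ?d ?d" "hermitian (S b)"
      using mat_line_carrier[OF H(1) A] hermitian_mat_line[OF H(1) A H(2) hA] by metis+
  qed
  have "cosh_potential s p (S True) + cosh_potential s p (S False) \<le> 2 * cosh s * cosh_potential s p H"
    unfolding S_def using cosh_potential_step[OF H(1) A H(2) hA] hs_contraction_measurement[OF E]
    by (simp add: A_def)
  then have "cosh_potential s p (S True) \<le> cosh s * cosh_potential s p H \<or>
      cosh_potential s p (S False) \<le> cosh s * cosh_potential s p H"
    by linarith
  then obtain b where b: "cosh_potential s p (S b) \<le> cosh s * cosh_potential s p H"
    by blast
  from Suc.IH[OF y S, of b b] obtain x H' where
    x: "x \<in> X" "(x, y) \<in> Z" "f x y = b" and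
    H': "H' \<in> carrier_mat ?d ?d" "hermitian H'"
      "Re (mtrace (S b * \<rho> x)) + n / 3 \<le> Re (mtrace (H' * \<rho> x))"
      "cosh_potential s p H' \<le> cosh s ^ n * cosh_potential s p (S b)"
    by blast
  have tr: "mtrace ((U + V) * \<rho> x) = mtrace (U * \<rho> x) + mtrace (V * \<rho> x)"
    "mtrace ((U - V) * \<rho> x) = mtrace (U * \<rho> x) - mtrace (V * \<rho> x)"
    if "U \<in> carrier_mat ?d ?d" "V \<in> carrier_mat ?d ?d" for U V
    using that \<rho>(1)[of x] add_mult_distrib_mat[OF that \<rho>(1)[of x]] minus_mult_distrib_mat[OF that \<rho>(1)[of x]]
      mtrace_add[of "U * \<rho> x" ?d "V * \<rho> x"] mtrace_minus[of "U * \<rho> x" ?d "V * \<rho> x"]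
    by simp_all
  have one: "mtrace ((1\<^sub>m ?d - E y) * \<rho> x) = 1 - mtrace (E y * \<rho> x)"
    unfolding tr(2)[OF one_carrier_mat E(1)] left_mult_one_mat[OF \<rho>(1)] \<rho>(2) ..
  \<comment> \<open>The correct outcome has probability at least 2/3, so the signed observable has
    expectation at least 2 * 2/3 - 1 = 1/3.\<close>
  have "Re (mtrace (H * \<rho> x)) + 1 / 3 \<le> Re (mtrace (S b * \<rho> x))"
    using correct[OF x(2)] unfolding x(3)
    by (cases b) (simp_all add: S_def tr[OF H(1) A] tr(2)[OF E(1) Ec, folded A_def] one)
  then have "Re (mtrace (H * \<rho> x)) + Suc n / 3 \<le> Re (mtrace (H' * \<rho> x))"
    using H'(3) by (simp add: add_divide_distrib)
  moreover have "cosh_potential s p H' \<le> cosh s ^ Suc n * cosh_potential s p H"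
  proof -
    have "cosh s ^ n * cosh_potential s p (S b) \<le> cosh s ^ n * (cosh s * cosh_potential s p H)"
      using b by (intro mult_left_mono) auto
    from order_trans[OF H'(4) this] show ?thesis by (simp add: mult_ac)
  qed
  ultimately show ?case using x(1) H' by blast
qed

text \<open>Needed because \<open>Q1\<close> may be \<open>0\<close>, in which case the message must be empty.\<close>
lemma no_mistake_tree_zero:
  assumes "k = 0"
  shows "\<not> mistake_tree Z f 1 X"
proof
  assume "mistake_tree Z f 1 X"
  then obtain y where "\<And>b. {x \<in> X. (x, y) \<in> Z \<and> f x y = b} \<noteq> {}" by auto
  from this[of True] this[of False] obtain x x'
    where x: "(x, y) \<in> Z" "f x y" "(x', y) \<in> Z" "\<not> f x' y" by auto
  have \<rho>: "\<rho> x \<in> carrier_mat 1 1" "\<rho> x $$ (0, 0) = 1" for x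
    using density[of x] assms by (auto simp: density_mat_def mtrace_def)
  have E: "E y \<in> carrier_mat 1 1" using povm[of y] assms by (simp add: povm_elem_def)
  have "mtrace (A * \<rho> x) = A $$ (0, 0)" if "A \<in> carrier_mat 1 1" for A x
    using mult_mat_index[OF that \<rho>(1)[of x], of 0 0] mtrace_carrier[OF mult_square_mat[OF that \<rho>(1)[of x]]] \<rho>(2)
    by simp
  note tr = this[OF E] this[OF minus_carrier_mat[OF E]]
  \<comment> \<open>A state of dimension 1 is the same for both inputs, yet Bob would have to give
    each answer with probability at least 2/3.\<close>
  have "2 / 3 \<le> Re (E y $$ (0, 0))" "2 / 3 \<le> Re ((1\<^sub>m 1 - E y) $$ (0, 0))"
    using correct[OF x(1)] correct[OF x(3)] x assms by (simp_all only: tr if_True if_False power_0)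
  then show False using E by simp
qed

text \<open>The walk starts at H = 0, where the potential is d = 2^k. At its end only the top term
  of the potential is kept; it dominates the 2p-th moment up to the factor d^2, and d^2 * d =
  2^(3k).\<close>

lemma mistake_tree_trace_bound:
  fixes s :: real
  assumes "mistake_tree Z f n X" "s > 0" "p = 2 ^ r"
  shows "(s * n / 3) ^ (2 * p) \<le> 2 ^ (3 * k) * fact (2 * p) * cosh s ^ n"
proof -
  let ?d = "2 ^ k :: nat"
  let ?O = "0\<^sub>m ?d ?d :: complex mat"
  have O: "?O \<in> carrier_mat ?d ?d" "hermitian ?O" by (auto intro!: hermitianI[of _ ?d])
  obtain x H where
    H: "H \<in> carrier_mat ?d ?d" "hermitian H" and
    ge: "Re (mtrace (?O * \<rho> x)) + n / 3 \<le> Re (mtrace (H * \<rho> x))" and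
    pot: "cosh_potential s p H \<le> cosh s ^ n * cosh_potential s p ?O"
    using mistake_tree_hypothesis[OF assms(1) O, of s p] by blast
  have \<rho>: "psd (\<rho> x)" "\<rho> x \<in> carrier_mat ?d ?d" "mtrace (\<rho> x) = 1"
    using density[of x] by (auto simp: density_mat_def)
  have "?O * \<rho> x = ?O" by (rule left_mult_zero_mat[OF \<rho>(2)])
  then have ge: "n / 3 \<le> Re (mtrace (H * \<rho> x))" using ge by (simp add: mtrace_def)
  have pot0: "cosh_potential s p ?O = ?d"
  proof -
    have "Re (mtrace (?O ^\<^sub>m (2 * q))) = (if q = 0 then real ?d else 0)" for q
    proof (cases q)
      case (Suc m)
      have "?O ^\<^sub>m (2 * q) = ?O ^\<^sub>m (Suc (2 * m)) * ?O" using Suc by simp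
      also have "\<dots> = ?O" by (rule right_mult_zero_mat) (rule pow_carrier_mat[OF O(1)])
      finally show ?thesis using Suc by (simp add: mtrace_def)
    qed (simp add: mtrace_def)
    then have "cosh_potential s p ?O = (\<Sum>q\<le>p. if q = 0 then real ?d else 0)"
      unfolding cosh_potential_def by (intro sum.cong refl) simp
    then show ?thesis by simp
  qed
  let ?T = "Re (mtrace (H ^\<^sub>m (2 * p)))"
  have "(s * n / 3) ^ (2 * p) = s ^ (2 * p) * (n / 3) ^ (2 * p)"
    by (simp add: power_mult_distrib[symmetric])
  also have "\<dots> \<le> s ^ (2 * p) * Re (mtrace (H * \<rho> x)) ^ (2 * p)"
    using ge assms(2) by (intro mult_left_mono power_mono) auto
  also have "\<dots> \<le> s ^ (2 * p) * ((real ?d)\<^sup>2 * ?T)"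
    unfolding assms(3) using assms(2) ge order_trans[of 0 "n / 3"]
    by (intro mult_left_mono expectation_pow_le_trace_pow H \<rho>) auto
  also have "\<dots> = (real ?d)\<^sup>2 * fact (2 * p) * (s ^ (2 * p) / fact (2 * p) * ?T)"
    by simp
  also have "s ^ (2 * p) / fact (2 * p) * ?T \<le> cosh_potential s p H"
    unfolding cosh_potential_def
    using assms(2) trace_even_pow_nonneg[OF H]
    by (intro member_le_sum[of p "{..p}" "\<lambda>q. s ^ (2 * q) / fact (2 * q) * Re (mtrace (H ^\<^sub>m (2 * q)))"]) auto
  then have "(real ?d)\<^sup>2 * fact (2 * p) * (s ^ (2 * p) / fact (2 * p) * ?T) \<le>
      (real ?d)\<^sup>2 * fact (2 * p) * (cosh s ^ n * ?d)"
    using pot unfolding pot0 by (intro mult_left_mono) auto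
  also have "\<dots> = 2 ^ (3 * k) * fact (2 * p) * cosh s ^ n"
  proof -
    have "(real ?d)\<^sup>2 * ?d = 2 ^ (3 * k)"
      by (simp add: power_mult[symmetric] power_add[symmetric])
    then show ?thesis by (simp add: mult_ac)
  qed
  finally show ?thesis .
qed

end

section \<open>Choice of the constants\<close>

lemma cosh_le_exp_square:
  fixes s :: real
  assumes "0 \<le> s" "s \<le> 1"
  shows "cosh s \<le> exp (s\<^sup>2)"
proof -
  have "exp (- s) = 1 / exp s" by (simp add: exp_minus field_simps)
  also have "\<dots> \<le> 1 / (1 + s)" using assms exp_ge_add_one_self[of s] by (intro divide_left_mono) auto
  also have "\<dots> \<le> 1 - s + s\<^sup>2"
    using assms by (simp add: field_simps power2_eq_square)
  \<comment> \<open>Averages exp(s) \<le> 1 + s + s^2 with the bound on exp(-s) just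
    obtained.\<close>
  finally have "cosh s \<le> 1 + s\<^sup>2" using exp_bound[OF assms] by (simp add: cosh_def)
  then show ?thesis using exp_ge_add_one_self[of "s\<^sup>2"] by linarith
qed

text \<open>The bound of \<open>mistake_tree_trace_bound\<close> at \<open>s = 1/30\<close> and \<open>n = 900 p\<close> reads
  \<open>25\<^sup>p (2p)\<^sup>2\<^sup>p \<le> 24\<^sup>p (2p)\<^sup>2\<^sup>p\<close> after estimating the right-hand side.\<close>
lemma mistake_tree_constants:
  fixes p k :: nat
  assumes "(1 / 30 * (900 * real p) / 3 :: real) ^ (2 * p) \<le> 2 ^ (3 * k) * fact (2 * p) * cosh (1 / 30 :: real) ^ (900 * p)"
    and "k \<le> p"
  shows "p = 0"
proof (rule ccontr)
  assume "p \<noteq> 0"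
  \<comment> \<open>The constants are matched: 900 * (1/30)^2 = 1 makes the growth at most e^p \<le>
    3^p, and (1/30) * 900 / 3 = 5 * 2 makes the left-hand side 25^p (2p)^(2p), against 8 * 3 = 24 on
    the right.\<close>
  have "cosh (1 / 30 :: real) ^ (900 * p) \<le> exp ((1 / 30)\<^sup>2) ^ (900 * p)"
    by (intro power_mono cosh_le_exp_square) auto
  also have "\<dots> = exp 1 ^ p"
    by (simp add: exp_of_nat_mult[symmetric] power2_eq_square)
  also have "\<dots> \<le> 3 ^ p" by (intro power_mono exp_le) auto
  finally have c: "cosh (1 / 30 :: real) ^ (900 * p) \<le> 3 ^ p" .
  define q where "q = (2 * real p) ^ (2 * p)"
  have q: "q > 0" using \<open>p \<noteq> 0\<close> by (simp add: q_def)
  have "fact (2 * p) \<le> q"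
    using fact_le_power[of "2 * p", where ?'a = real] by (simp add: q_def)
  moreover have "(2 :: real) ^ (3 * k) \<le> 2 ^ (3 * p)" using assms(2) by (intro power_increasing) auto
  then have "(2 :: real) ^ (3 * k) \<le> 8 ^ p" unfolding power_mult by simp
  ultimately have "2 ^ (3 * k) * fact (2 * p) * cosh (1 / 30 :: real) ^ (900 * p) \<le> 8 ^ p * q * 3 ^ p"
    using c q by (intro mult_mono) simp_all
  also have "\<dots> = (8 * 3) ^ p * q"
    unfolding power_mult_distrib by (simp only: mult_ac)
  also have "\<dots> < 25 ^ p * q"
    using \<open>p \<noteq> 0\<close> q by (intro mult_strict_right_mono power_strict_mono) simp_all
  also have "25 ^ p = (5 :: real) ^ (2 * p)"
    unfolding power_mult by simp
  also have "\<dots> * q = (1 / 30 * (900 * real p) / 3) ^ (2 * p)"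
    unfolding q_def power_mult_distrib[symmetric] by simp
  finally show False using assms(1) by linarith
qed

lemma no_mistake_tree_of_Q1_protocol:
  assumes "Q1_protocol Z f k"
  obtains n where "\<not> mistake_tree Z f n X" "n \<le> 1800 * k \<or> k = 0 \<and> n = 1"
proof -
  obtain \<rho> E where dens: "\<And>x. density_mat k (\<rho> x)" and povm: "\<And>y. povm_elem k (E y)"
    and corr: "\<And>x y. (x, y) \<in> Z \<Longrightarrow>
      Re (mtrace ((if f x y then E y else 1\<^sub>m (2 ^ k) - E y) * \<rho> x)) \<ge> 2 / 3"
    using assms unfolding Q1_protocol_def by blast
  show ?thesis
  proof (cases "k = 0")
    case True
    have "\<not> mistake_tree Z f 1 X" by (rule no_mistake_tree_zero[OF dens povm corr True])
    then show ?thesis using True by (intro that[of 1]) simp_all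
  next
    case False
    \<comment> \<open>The moment order must be a power of two that is at least k. The least one
      above k is at most 2k, whence 900 p \<le> 1800 k.\<close>
    then obtain r where r: "2 ^ r \<le> k" "k < 2 ^ (r + 1)"
      using ex_power_ivl1[of 2 k] by auto
    define p :: nat where "p = 2 ^ (r + 1)"
    have p: "k \<le> p" "p \<le> 2 * k" "p \<noteq> 0" using r by (auto simp: p_def)
    have "\<not> mistake_tree Z f (900 * p) X"
    proof
      assume "mistake_tree Z f (900 * p) X"
      from mistake_tree_trace_bound[OF dens povm corr this _ p_def, where s = "1 / 30"]
      show False using mistake_tree_constants[of p k] p by simp
    qed
    then show ?thesis using that[of "900 * p"] p by simp
  qed
qed

subsection \<open>The classical protocol\<close>

text \<open>The message is a code word of a hypothesis in \<open>G\<close> that is correct for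
  \<open>x\<close>; Bob decodes and evaluates it. The distributions are point masses, so the success
  probability is 1.\<close>

lemma R1_protocol_of_cover:
  assumes "finite G" "card G \<le> 2 ^ K"
    and "\<And>x. \<exists>g\<in>G. \<forall>y. (x, y) \<in> Z \<longrightarrow> g y = f x y"
  shows "R1_protocol Z f K"
proof -
  let ?S = "{m :: bool list. length m = K}"
  have S: "finite ?S" "card ?S = 2 ^ K"
    using finite_lists_length_eq[of "UNIV :: bool set" K] card_lists_length_eq[of "UNIV :: bool set" K]
    by (simp_all)
  obtain e where e: "e ` G \<subseteq> ?S" "inj_on e G"
    using card_le_inj[OF assms(1) S(1)] assms(2) S(2) by auto
  obtain g where g: "\<And>x. g x \<in> G" "\<And>x y. (x, y) \<in> Z \<Longrightarrow> g x y = f x y"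
    using assms(3) by metis
  show ?thesis unfolding R1_protocol_def
  proof (intro exI conjI)
    show "\<forall>x. set_pmf (return_pmf (e (g x))) \<subseteq> {m. length m = K}" using e g by auto
    show "\<forall>(x, y) \<in> Z. measure_pmf.prob (return_pmf (e (g x)))
        {m. inv_into G e m y = f x y} \<ge> 2/3"
      using e g by (auto simp: inv_into_f_f)
  qed
qed

text \<open>Ensures that the \<open>LEAST\<close> in \<open>Q1\<close> is attained. Alice sends
  \<open>x\<close> as a computational basis state and Bob measures the diagonal projection onto the
  inputs with value true.\<close>

lemma Q1_protocol_exists:
  assumes "Z \<subseteq> {x. length x = N} \<times> UNIV"
  shows "Q1_protocol Z f N"
proof -
  let ?S = "{x :: bool list. length x = N}"
  have S: "finite ?S" "card ?S = 2 ^ N"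
    using finite_lists_length_eq[of "UNIV :: bool set" N] card_lists_length_eq[of "UNIV :: bool set" N]
    by (simp_all)
  obtain h :: "bool list \<Rightarrow> nat" where h: "bij_betw h ?S {0..<2 ^ N}"
    using ex_bij_betw_finite_nat[OF S(1)] unfolding S(2) by blast
  \<comment> \<open>A state is demanded for every list, so lists of a wrong length are sent to basis
    index 0.\<close>
  define e where "e x = (if x \<in> ?S then h x else 0)" for x
  have e: "e x < 2 ^ N" for x
    using bij_betwE[OF h] by (auto simp: e_def)
  define r where "r x = mat (2^N) (2^N) (\<lambda>(i, j). if i = j \<and> i = e x then 1 else 0 :: complex)" for x
  define D where "D v = mat (2^N) (2^N) (\<lambda>(i, j). if i = j \<and> v i then 1 else 0 :: complex)" for v
  have r: "r x = D (\<lambda>i. i = e x)" for x unfolding r_def D_def by simp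
  have psd: "psd (D v)" for v
  proof -
    have "0 \<le> Re (\<Sum>i<2^N. \<Sum>j<2^N. cnj (vec_index u i) * (if i = j \<and> v i then 1 else 0) * vec_index u j)"
      (is "0 \<le> Re ?s") for u :: "complex Matrix.vec"
    proof -
      have "?s = (\<Sum>i<2^N. \<Sum>j<2^N. if j = i then (if v i then cnj (vec_index u i) * vec_index u i else 0) else 0)"
        by (intro sum.cong refl) auto
      also have "Re \<dots> \<ge> 0"
        by (simp add: sum.delta) (intro sum_nonneg, auto)
      finally show ?thesis .
    qed
    then show ?thesis
      unfolding psd_def by (simp add: D_def)
  qed
  have "1\<^sub>m (2 ^ N) - D v = D (\<lambda>i. \<not> v i)" for v
    by (rule eq_matI) (auto simp: D_def)
  then have povm: "povm_elem N (D v)" for v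
    by (simp add: povm_elem_def psd) (simp add: D_def)
  have dens: "density_mat N (r x)" for x
    using e[of x] unfolding density_mat_def r by (simp add: psd) (simp add: mtrace_def D_def)
  have tr: "mtrace (D v * r x) = (if v (e x) then 1 else 0)" for v x
  proof -
    have "mtrace (D v * r x) = (\<Sum>i<2^N. \<Sum>j = 0..<2^N.
        (if i = j \<and> v i then 1 else 0) * (if j = i \<and> j = e x then 1 else 0))"
      unfolding mtrace_def r_def D_def by (simp add: scalar_prod_def)
    also have "\<dots> = (\<Sum>i<2^N. \<Sum>j = 0..<2^N. if i = j then (if i = e x \<and> v (e x) then 1 else 0) else 0)"
      by (intro sum.cong refl) auto
    also have "\<dots> = (\<Sum>i<2^N. if i = e x then (if v (e x) then 1 else 0) else 0)"
      by (intro sum.cong refl) simp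
    finally show ?thesis using e[of x] by simp
  qed
  show ?thesis unfolding Q1_protocol_def
  proof (intro exI conjI)
    show "\<forall>x. density_mat N (r x)" using dens by simp
    let ?E = "\<lambda>y. D (\<lambda>i. f (inv_into ?S h i) y)"
    show "\<forall>y. povm_elem N (?E y)" using povm by simp
    have "f (inv_into ?S h (e x)) y = f x y" if "(x, y) \<in> Z" for x y
    proof -
      have "x \<in> ?S" using that assms by auto
      then show ?thesis using h by (simp add: e_def bij_betw_def inv_into_f_f)
    qed
    then show "\<forall>(x, y)\<in>Z. 2 / 3 \<le> Re (mtrace ((if f x y then ?E y else 1\<^sub>m (2 ^ N) - ?E y) * r x))"
      using tr \<open>\<And>v. 1\<^sub>m (2 ^ N) - D v = D (\<lambda>i. \<not> v i)\<close> by (auto simp: case_prod_beta)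
  qed
qed

theorem theorem4:
  "\<exists>C::real. C > 0 \<and>
     (\<forall>(N::nat) (M::nat) (Z :: (bool list \<times> bool list) set) (f :: bool list \<Rightarrow> bool list \<Rightarrow> bool).
        N > 0 \<longrightarrow> M > 0 \<longrightarrow>
        Z \<subseteq> {x. length x = N} \<times> {y. length y = M} \<longrightarrow>
        real (R1 Z f) \<le> C * real M * real (Q1 Z f))"
\<comment> \<open>3600 = 2 * 1800: at most 2M bits for each of at most 1800 k levels.\<close>
proof (intro exI[of _ 3600] conjI allI impI)
  fix N M :: nat and Z :: "(bool list \<times> bool list) set" and f :: "bool list \<Rightarrow> bool list \<Rightarrow> bool"
  assume M: "M > 0" and Z: "Z \<subseteq> {x. length x = N} \<times> {y. length y = M}"
  define k where "k = Q1 Z f"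
  let ?Y = "{y :: bool list. length y = M}"
  have Y: "finite ?Y" "card ?Y = 2 ^ M"
    using finite_lists_length_eq[of "UNIV :: bool set" M] card_lists_length_eq[of "UNIV :: bool set" M]
    by simp_all
  have "Q1_protocol Z f k"
    unfolding k_def Q1_def by (rule LeastI[of _ N], rule Q1_protocol_exists) (use Z in auto)
  then obtain n where tree: "\<not> mistake_tree Z f n UNIV" and n: "n \<le> 1800 * k \<or> k = 0 \<and> n = 1"
    by (rule no_mistake_tree_of_Q1_protocol)
  have "Z \<subseteq> UNIV \<times> ?Y" using Z by auto
  from predictor_cover[OF Y(1) this tree] obtain G where
    G: "finite G" "2 ^ M * card G + 1 \<le> (2 ^ M + 1) ^ n" and
    cover: "\<And>x. \<exists>g\<in>G. \<forall>y. (x, y) \<in> Z \<longrightarrow> g y = f x y"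
    unfolding Y(2) by auto
  have "card G \<le> 2 ^ (2 * M * (1800 * k))"
    using n
  proof
    assume n: "n \<le> 1800 * k"
    have "card G \<le> 2 ^ M * card G" by simp
    also have "\<dots> \<le> (2 ^ M + 1) ^ n" using G(2) by simp
    also have "\<dots> \<le> (2 ^ (2 * M)) ^ n"
    proof (rule power_mono)
      have "(2 :: nat) ^ M + 1 \<le> 2 ^ M + 2 ^ M" by simp
      also have "\<dots> = 2 ^ Suc M" by simp
      also have "\<dots> \<le> 2 ^ (2 * M)" using M by (intro power_increasing) auto
      finally show "(2 :: nat) ^ M + 1 \<le> 2 ^ (2 * M)" .
    qed simp
    also have "\<dots> \<le> (2 ^ (2 * M)) ^ (1800 * k)" using n by (intro power_increasing) auto
    finally show ?thesis by (simp only: power_mult)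
  next
    \<comment> \<open>For n = 1 the counting bound reads 2^M |G| + 1 \<le> 2^M + 1, so there is at
      most one hypothesis and the empty message suffices.\<close>
    assume "k = 0 \<and> n = 1"
    with G(2) show ?thesis by simp
  qed
  then have "R1_protocol Z f (2 * M * (1800 * k))" by (rule R1_protocol_of_cover[OF G(1) _ cover])
  then have "R1 Z f \<le> 2 * M * (1800 * k)" unfolding R1_def by (rule Least_le)
  then have "real (R1 Z f) \<le> real (2 * M * (1800 * k))" by (simp only: of_nat_le_iff)
  then show "real (R1 Z f) \<le> 3600 * real M * real (Q1 Z f)" by (simp add: k_def)
qed simp

end
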